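(* Let $G$ be a finite abelian group with $\operatorname{diam}^+(G)\ge4$. (i) If $3$ divides $|G|$, then $t_4(G)=\frac13|G|$; if every divisor of $|G|$ is congruent to $1$ modulo $3$, then $t_4(G)=\frac13(|G|-1)$. (ii) If $G$ is not of exponent $2$, then $$s_4(G)=\begin{cases}\frac13(|G|+\eta(G)) & \text{if } \eta(G)\neq0,\\ \frac13|G| & \text{if } \eta(G)=0 \text{ and } 3\mid |G|,\\ \frac13(|G|-1) & \text{if } \eta(G)=0 \text{ and } 3\nmid|G|.\end{cases}$$
   Context: Groups are written additively. For $A\subseteq G$ let $A_0:=A\cup\{0\}$ and $\langle A\rangle^+_\rho:=\rho A_0=\{a_1+\dots+a_\rho:a_i\in A_0\}$. $\operatorname{diam}^+_A(G):=\min\{\rho\in\mathbb{N}_0:\langle A\rangle^+_\rho=G\}$ ($\min\varnothing=\infty$); $\operatorname{diam}^+(G):=\max\{\operatorname{diam}^+_A(G):\langle A\rangle=G\}$. The period of $S\subseteq G$ is $\pi(S):=\{g\in G:S+g=S\}$; $S$ is aperiodic if $\pi(S)=\{0\}$. A subset $A\subseteq G$ is $\rho$-maximal if it is maximal under inclusion subject to $\operatorname{diam}^+_A(G)\ge\rho$, i.e. subject to $\langle A\rangle^+_{\rho-1}\neq G$. With the convention $\max\varnothing=0$: $s_\rho(G):=\max\{|A|: A\subseteq G,\ \rho\le\operatorname{diam}^+_A(G)<\infty\}$ and $t_\rho(G):=\max\{|A|: A \text{ is an aperiodic } \rho\text{-maximal generating set for } G\}$. Finally $\eta(G):=\max\{|H|: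 H\le G,\ \exp(G/H)\neq 2,\ |G/H|\equiv 2 \pmod 3\}\in\mathbb{N}_0$ (with $\max\varnothing=0$). *)

theory Defs
  imports Complex_Main "HOL-Library.Extended_Nat"
begin

text \<open>The finite abelian group G is the universe of a type of class
  ab_group_add and finite.\<close>

definition add_subgroup :: "'a::ab_group_add set \<Rightarrow> bool" where
  "add_subgroup H \<longleftrightarrow> 0 \<in> H \<and> (\<forall>x\<in>H. \<forall>y\<in>H. x + y \<in> H) \<and> (\<forall>x\<in>H. - x \<in> H)"

definition gen_subgroup :: "'a::ab_group_add set \<Rightarrow> 'a set" where
  "gen_subgroup A = \<Inter>{H. add_subgroup H \<and> A \<subseteq> H}"

definition nsmul :: "nat \<Rightarrow> 'a::ab_group_add \<Rightarrow> 'a" where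
  "nsmul n g = (((+) g) ^^ n) 0"

definition cosets :: "'a::ab_group_add set \<Rightarrow> 'a set set" where
  "cosets H = {(\<lambda>h. g + h) ` H | g. True}"

definition exp_quot :: "'a::ab_group_add set \<Rightarrow> nat" where
  "exp_quot H = (LEAST n. 0 < n \<and> (\<forall>g::'a. nsmul n g \<in> H))"

definition group_exp :: "'a::ab_group_add itself \<Rightarrow> nat" where
  "group_exp _ = (LEAST n. 0 < n \<and> (\<forall>g::'a. nsmul n g = 0))"

definition rho_sumset :: "'a::ab_group_add set \<Rightarrow> nat \<Rightarrow> 'a set" where
  "rho_sumset A \<rho> = {sum_list xs | xs. length xs = \<rho> \<and> set xs \<subseteq> insert 0 A}"

definition diamA :: "'a::ab_group_add set \<Rightarrow> enat" where
  "diamA A = (if \<exists>\<rho>. rho_sumset A \<rho> = UNIV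
              then enat (LEAST \<rho>. rho_sumset A \<rho> = UNIV) else \<infinity>)"

definition diam :: "'a::ab_group_add itself \<Rightarrow> enat" where
  "diam _ = Sup {diamA (A::'a set) | A. gen_subgroup A = UNIV}"

definition period :: "'a::ab_group_add set \<Rightarrow> 'a set" where
  "period S = {g. (\<lambda>s. s + g) ` S = S}"

definition aperiodic :: "'a::ab_group_add set \<Rightarrow> bool" where
  "aperiodic S \<longleftrightarrow> period S = {0}"

definition rho_maximal :: "nat \<Rightarrow> 'a::ab_group_add set \<Rightarrow> bool" where
  "rho_maximal \<rho> A \<longleftrightarrow> enat \<rho> \<le> diamA A \<and> (\<forall>B. A \<subset> B \<longrightarrow> \<not> enat \<rho> \<le> diamA B)"

definition s_rho :: "'a::ab_group_add itself \<Rightarrow> nat \<Rightarrow> nat" where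
  "s_rho _ \<rho> = Max ({card (A::'a set) | A. enat \<rho> \<le> diamA A \<and> diamA A < \<infinity>} \<union> {0})"

definition t_rho :: "'a::ab_group_add itself \<Rightarrow> nat \<Rightarrow> nat" where
  "t_rho _ \<rho> = Max ({card (A::'a set) | A. aperiodic A \<and> rho_maximal \<rho> A \<and> gen_subgroup A = UNIV} \<union> {0})"

definition eta :: "'a::ab_group_add itself \<Rightarrow> nat" where
  "eta _ = Max ({card (H::'a set) | H. add_subgroup H \<and> exp_quot H \<noteq> 2 \<and> card (cosets H) mod 3 = 2} \<union> {0})"

end

theory Submission
  imports Defs "HOL-Library.Set_Algebras"
begin

text \<open>
  Put \<open>B = A \<union> {0}\<close>; then \<open>diam A \<ge> 4\<close> means \<open>B + B + B \<noteq> G\<close>. If \<open>c\<close> is missed, then \<open>c - B\<close> avoids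
  \<open>B + B\<close>, and Kneser's theorem gives \<open>3 |B + H| \<le> |G| + |H|\<close> for the period \<open>H\<close> of \<open>B + B\<close>. Counting
  cosets modulo 3 yields the upper bounds, except when \<open>G/H\<close> has exponent 2 and \<open>|G/H| \<equiv> 2 (mod 3)\<close>;
  there \<open>c + B + H\<close> would be a sum-free set of density above \<open>1/3\<close>, which forces \<open>B\<close> into a subgroup of
  index 2. A maximal aperiodic \<open>A\<close> equals \<open>B + H\<close>, so \<open>H\<close> is trivial.

  The lower bounds come from cyclic quotients \<open>G/K\<close> of order \<open>3k + 2\<close> or \<open>3k + 1\<close>: take the cosets
  \<open>0, \<dots>, k\<close>, or the cosets \<open>0, \<dots>, k - 1\<close> together with a copy, in coset \<open>k\<close>, of a set constructed
  recursively in \<open>K\<close>. If 3 divides \<open>|G|\<close>, one element of a subgroup of index 3 is exchanged for an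
  element outside it.
\<close>

section \<open>Subgroups and periods\<close>

text \<open>Kneser's theorem ignores generation, and this is the obstacle: a subgroup of index 2
  attains the bound but does not generate. If \<open>m\<close> is the index of \<open>H\<close> and
  \<open>b\<close> the number of its cosets in \<open>B + H\<close>, the case
  \<open>3 b = m + 1\<close> has to be refuted exactly when \<open>G/H\<close> has exponent 2. For
  every other \<open>G/H\<close> with \<open>m\<close> congruent to 2 some generating set does at
  least as well, whence the form of \<open>eta\<close>. For the lower bounds, the interval
  \<open>0, ..., k\<close> in a cyclic group of order \<open>3k + 2\<close> has triple sums up to
  \<open>3k\<close> only and misses \<open>3k + 1\<close>. In order \<open>3k + 1\<close> these sums
  fill everything, so the top coset has to be thinned, by a set whose threefold sumset misses a
  point of \<open>K\<close>. Containing 0 and generating require \<open>k\<close> positive and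
  residue 1 met. So the quotient must have order at least 3, which is where exponent other than 2
  enters, and order 4 is the one exception. Subsets of \<open>G/H\<close> are represented by
  \<open>H\<close>-periodic subsets of \<open>G\<close>, and chains of maximal subgroups replace the
  structure theorem.\<close>

lemma add_subgroupD:
  assumes "add_subgroup H"
  shows "0 \<in> H" "\<And>x y. x \<in> H \<Longrightarrow> y \<in> H \<Longrightarrow> x + y \<in> H" "\<And>x. x \<in> H \<Longrightarrow> - x \<in> H"
    "\<And>x y. x \<in> H \<Longrightarrow> y \<in> H \<Longrightarrow> x - y \<in> H"
proof -
  show 0: "0 \<in> H" and 1: "\<And>x y. x \<in> H \<Longrightarrow> y \<in> H \<Longrightarrow> x + y \<in> H" and 2: "\<And>x. x \<in> H \<Longrightarrow> - x \<in> H"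
    using assms unfolding add_subgroup_def by auto
  show "x - y \<in> H" if "x \<in> H" "y \<in> H" for x y
    using 1[OF that(1) 2[OF that(2)]] by simp
qed

lemma add_subgroup_add_cancel:
  assumes "add_subgroup H" "h \<in> H"
  shows "x + h \<in> H \<longleftrightarrow> x \<in> H" "h + x \<in> H \<longleftrightarrow> x \<in> H"
  using add_subgroupD(2)[OF assms(1), of x h] add_subgroupD(4)[OF assms(1), of "x + h" h] assms(2)
  by (auto simp: add.commute)

lemma nsmul_0 [simp]: "nsmul 0 g = 0"
  and nsmul_Suc [simp]: "nsmul (Suc n) g = g + nsmul n g"
  by (simp_all add: nsmul_def)

lemma nsmul_add: "nsmul (m + n) g = nsmul m g + nsmul n g"
  by (induction m) (simp_all add: add.assoc)

lemma nsmul_one [simp]: "nsmul 1 g = g"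
  by (simp add: nsmul_def)

lemma nsmul_two: "nsmul 2 g = g + g"
  by (simp add: numeral_2_eq_2)

lemma nsmul_three: "nsmul 3 g = g + g + g"
  by (simp add: numeral_3_eq_3 add.assoc)

lemma nsmul_mult: "nsmul (m * n) g = nsmul m (nsmul n g)"
  by (induction m) (simp_all add: nsmul_add)

lemma nsmul_distrib: "nsmul n (x + y) = nsmul n x + nsmul n y"
  by (induction n) (simp_all add: algebra_simps)

lemma nsmul_mem: "add_subgroup H \<Longrightarrow> g \<in> H \<Longrightarrow> nsmul n g \<in> H"
  by (induction n) (auto intro: add_subgroupD)

text \<open>Translation by a member maps the finite set \<open>H\<close> injectively into itself,
  hence onto, and so reaches 0.\<close>

lemma add_subgroup_finiteI:
  fixes H :: "'a::{ab_group_add, finite} set"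
  assumes "0 \<in> H" "\<And>x y. x \<in> H \<Longrightarrow> y \<in> H \<Longrightarrow> x + y \<in> H"
  shows "add_subgroup H"
proof -
  have "- x \<in> H" if "x \<in> H" for x
  proof -
    have "(+) x ` H \<subseteq> H" using assms(2)[OF that] by auto
    moreover have "card ((+) x ` H) = card H" by (rule card_image) simp
    ultimately have "(+) x ` H = H" by (meson card_subset_eq finite)
    then obtain y where "y \<in> H" "0 = x + y" using assms(1) by (metis imageE)
    then show ?thesis by (metis minus_unique)
  qed
  then show ?thesis using assms by (simp add: add_subgroup_def)
qed

lemma add_subgroup_inter: "add_subgroup H \<Longrightarrow> add_subgroup K \<Longrightarrow> add_subgroup (H \<inter> K)"
  unfolding add_subgroup_def by auto

lemma mem_period_iff:
  fixes S :: "'a::{ab_group_add, finite} set"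
  shows "g \<in> period S \<longleftrightarrow> (\<forall>s\<in>S. s + g \<in> S)"
proof
  assume "\<forall>s\<in>S. s + g \<in> S"
  then have "(\<lambda>s. s + g) ` S \<subseteq> S" by auto
  moreover have "card ((\<lambda>s. s + g) ` S) = card S" by (rule card_image) simp
  ultimately show "g \<in> period S" unfolding period_def by (simp add: card_subset_eq)
qed (auto simp: period_def)

lemma add_subgroup_period: "add_subgroup (period (S :: 'a::{ab_group_add, finite} set))"
  by (rule add_subgroup_finiteI) (simp_all add: mem_period_iff flip: add.assoc)

lemma period_translate:
  fixes S :: "'a::{ab_group_add, finite} set"
  shows "period ((+) x ` S) = period S"
  by (auto simp: mem_period_iff add.assoc image_iff)

lemma card_translate [simp]: "card ((+) (x::'a::ab_group_add) ` S) = card S"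
  by (rule card_image) simp

lemma set_plus_period [simp]:
  fixes S :: "'a::{ab_group_add, finite} set"
  shows "S + period S = S"
proof
  show "S + period S \<subseteq> S" by (auto elim!: set_plus_elim simp: mem_period_iff)
  show "S \<subseteq> S + period S"
    using set_plus_intro[of _ S 0 "period S"] add_subgroupD(1)[OF add_subgroup_period[of S]] by auto
qed

lemma subgroup_le_period_iff:
  fixes S :: "'a::{ab_group_add, finite} set"
  shows "H \<subseteq> period S \<longleftrightarrow> (\<forall>s\<in>S. \<forall>h\<in>H. s + h \<in> S)"
  by (auto simp: mem_period_iff)

lemma set_plus_subgroup_idem: "add_subgroup H \<Longrightarrow> H + H = H"
  using set_plus_intro[of _ H 0 H] by (auto elim!: set_plus_elim intro: add_subgroupD)

lemma mem_coset_iff: "x \<in> (+) g ` H \<longleftrightarrow> x - (g::'a::ab_group_add) \<in> H"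
  by (metis add_diff_cancel_left' diff_add_cancel add.commute image_iff)

lemma coset_eq_iff:
  assumes "add_subgroup H"
  shows "(+) x ` H = (+) y ` H \<longleftrightarrow> x - y \<in> H"
proof
  assume "(+) x ` H = (+) y ` H"
  moreover have "x \<in> (+) x ` H" using add_subgroupD(1)[OF assms] by (auto simp: mem_coset_iff)
  ultimately show "x - y \<in> H" by (simp add: mem_coset_iff)
next
  assume "x - y \<in> H"
  then have "z - y \<in> H \<longleftrightarrow> z - x \<in> H" for z
    using add_subgroup_add_cancel(1)[OF assms, of "x - y" "z - x"] by simp
  then show "(+) x ` H = (+) y ` H" by (simp add: set_eq_iff mem_coset_iff)
qed

text \<open>\<open>S\<close> is a disjoint union of cosets of \<open>H\<close>; the family of these
  cosets plays the part of the image of \<open>S\<close> in the quotient.\<close>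

lemma card_periodic:
  fixes S :: "'a::{ab_group_add, finite} set"
  assumes H: "add_subgroup H" and S: "H \<subseteq> period S"
  shows "card S = card H * card ((\<lambda>s. (+) s ` H) ` S)"
proof -
  have U: "\<Union>((\<lambda>s. (+) s ` H) ` S) = S"
  proof
    show "\<Union>((\<lambda>s. (+) s ` H) ` S) \<subseteq> S" using S by (auto simp: mem_period_iff subset_iff)
    show "S \<subseteq> \<Union>((\<lambda>s. (+) s ` H) ` S)" using add_subgroupD(1)[OF H] by (auto simp: mem_coset_iff)
  qed
  have "card H * card ((\<lambda>s. (+) s ` H) ` S) = card (\<Union>((\<lambda>s. (+) s ` H) ` S))"
  proof (rule card_partition)
    fix c1 c2 assume c: "c1 \<in> (\<lambda>s. (+) s ` H) ` S" "c2 \<in> (\<lambda>s. (+) s ` H) ` S" "c1 \<noteq> c2"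
    then obtain x y where xy: "c1 = (+) x ` H" "c2 = (+) y ` H" by auto
    show "c1 \<inter> c2 = {}"
    proof (rule ccontr)
      assume "c1 \<inter> c2 \<noteq> {}"
      then obtain z where "z \<in> c1" "z \<in> c2" by blast
      then have "z - x \<in> H" "z - y \<in> H" using xy by (simp_all only: mem_coset_iff)
      then have "(z - y) - (z - x) \<in> H" using add_subgroupD(4)[OF H] by blast
      then show False using c xy coset_eq_iff[OF H] by simp
    qed
  qed auto
  then show ?thesis using U by simp
qed

lemma card_cosets:
  fixes H :: "'a::{ab_group_add, finite} set"
  assumes "add_subgroup H"
  shows "card (UNIV :: 'a set) = card H * card (cosets H)"
proof -
  have "cosets H = (\<lambda>s. (+) s ` H) ` UNIV" by (auto simp: cosets_def)
  then show ?thesis using card_periodic[OF assms, of UNIV] by (simp add: subgroup_le_period_iff)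
qed

lemma card_subgroup_pos:
  fixes H :: "'a::{ab_group_add, finite} set"
  shows "add_subgroup H \<Longrightarrow> 0 < card H"
  using add_subgroupD(1) card_gt_0_iff finite by blast

section \<open>Kneser's theorem\<close>

text \<open>The fibres of \<open>(u, v) \<mapsto> u + v\<close> are differences in \<open>H1 \<inter> H2\<close>.\<close>

lemma card_times_le_card_plus:
  fixes H1 H2 U V :: "'a::{ab_group_add, finite} set"
  assumes H: "add_subgroup H1" "add_subgroup H2" and UV: "U \<subseteq> H2" "V \<subseteq> H1"
  shows "card U * card V \<le> card (U + V) * card (H1 \<inter> H2)"
proof -
  let ?F = "\<lambda>s. {(u, v). u \<in> U \<and> v \<in> V \<and> u + v = s}"
  have fib: "card (?F s) \<le> card (H1 \<inter> H2)" for s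
  proof (cases "?F s = {}")
    case False
    then obtain u0 v0 where o: "u0 \<in> U" "v0 \<in> V" "u0 + v0 = s" by auto
    have "(\<lambda>(u, v). u - u0) ` ?F s \<subseteq> H1 \<inter> H2"
    proof clarify
      fix u v assume a: "u \<in> U" "v \<in> V" "s = u + v"
      have "u - u0 = v0 - v" using a o by (simp add: algebra_simps)
      moreover have "u - u0 \<in> H2" "v0 - v \<in> H1" using a o UV H add_subgroupD(4) by blast+
      ultimately show "u - u0 \<in> H1 \<inter> H2" by simp
    qed
    moreover have "inj_on (\<lambda>(u, v). u - u0) (?F s)" by (auto simp: inj_on_def)
    ultimately show ?thesis by (meson card_inj_on_le finite)
  qed (metis card.empty zero_le)
  have "U \<times> V = (\<Union>s\<in>U + V. ?F s)" by (auto intro: set_plus_intro)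
  then have "card (U \<times> V) \<le> (\<Sum>s\<in>U + V. card (?F s))" using card_UN_le[of "U + V" ?F] by simp
  also have "\<dots> \<le> card (U + V) * card (H1 \<inter> H2)" using sum_bounded_above[OF fib] by simp
  finally show ?thesis by (simp add: card_cartesian_product)
qed

text \<open>Modulo \<open>H1 \<inter> H2\<close>, the coset of \<open>H1 + H2\<close> through
  \<open>x\<close> is a grid with coordinates in \<open>H2\<close> and \<open>H1\<close>. Membership
  in \<open>C1\<close> depends only on the first coordinate, membership in \<open>C2\<close> only on
  the second. So \<open>U + V\<close> translates into \<open>C1 - C2\<close> and
  \<open>U' + V'\<close> into \<open>C2 - C1\<close>: complementary rectangles, which cannot both be
  small.\<close>

lemma union_period_aux:
  fixes C1 C2 :: "'a::{ab_group_add, finite} set"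
  defines "H1 \<equiv> period C1" and "H2 \<equiv> period C2"
  assumes x: "x \<in> C1 - C2"
  shows "card H1 \<le> card (C1 - C2) \<or> card H2 \<le> card (C1 - C2) + card (H1 \<inter> H2)
       \<or> card H1 \<le> card (C2 - C1) + card (H1 \<inter> H2)"
proof -
  let ?k = "card (H1 \<inter> H2)"
  have H: "add_subgroup H1" "add_subgroup H2" by (simp_all add: H1_def H2_def add_subgroup_period)
  have p1: "s + h \<in> C1 \<longleftrightarrow> s \<in> C1" if "h \<in> H1" for s h
  proof -
    have "s + h - h \<in> C1" if "s + h \<in> C1"
      using that add_subgroupD(3)[OF H(1) \<open>h \<in> H1\<close>] by (metis H1_def mem_period_iff uminus_add_conv_diff add.commute)
    then show ?thesis using that by (auto simp: H1_def mem_period_iff)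
  qed
  have p2: "s + h \<in> C2 \<longleftrightarrow> s \<in> C2" if "h \<in> H2" for s h
  proof -
    have "s + h - h \<in> C2" if "s + h \<in> C2"
      using that add_subgroupD(3)[OF H(2) \<open>h \<in> H2\<close>] by (metis H2_def mem_period_iff uminus_add_conv_diff add.commute)
    then show ?thesis using that by (auto simp: H2_def mem_period_iff)
  qed
  define U where "U = {h\<in>H2. x + h \<in> C1}"
  define U' where "U' = {h\<in>H2. x + h \<notin> C1}"
  define V where "V = {h\<in>H1. x + h \<notin> C2}"
  define V' where "V' = {h\<in>H1. x + h \<in> C2}"
  have kpos: "0 < ?k" using card_subgroup_pos[OF add_subgroup_inter[OF H]] .
  have "(+) x ` (U + V) \<subseteq> C1 - C2"
    by (auto elim!: set_plus_elim simp: U_def V_def p1 p2 add.assoc[symmetric])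
       (metis add.assoc add.commute p2)
  then have "card (U + V) \<le> card (C1 - C2)" by (metis card_mono card_translate finite)
  moreover have "card U * card V \<le> card (U + V) * ?k"
    by (rule card_times_le_card_plus[OF H]) (auto simp: U_def V_def)
  ultimately have e1: "card U * card V \<le> card (C1 - C2) * ?k" by (meson le_trans mult_le_mono1)
  have "(+) x ` (U' + V') \<subseteq> C2 - C1"
    by (auto elim!: set_plus_elim simp: U'_def V'_def p1 p2 add.assoc[symmetric])
       (metis add.assoc add.commute p2)
  then have "card (U' + V') \<le> card (C2 - C1)" by (metis card_mono card_translate finite)
  moreover have "card U' * card V' \<le> card (U' + V') * ?k"
    by (rule card_times_le_card_plus[OF H]) (auto simp: U'_def V'_def)
  ultimately have e2: "card U' * card V' \<le> card (C2 - C1) * ?k" by (meson le_trans mult_le_mono1)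
  \<comment> \<open>The four sets are unions of cosets of \<open>H1 \<inter> H2\<close>, hence have
    at least \<open>?k\<close> elements unless empty.\<close>
  have big: "?k \<le> card S" if "h \<in> S" "\<And>h k. h \<in> S \<Longrightarrow> k \<in> H1 \<inter> H2 \<Longrightarrow> h + k \<in> S" for h S
  proof -
    have "(+) h ` (H1 \<inter> H2) \<subseteq> S" using that by auto
    then show ?thesis by (metis card_mono card_translate finite)
  qed
  have bU: "?k \<le> card U"
    using x by (intro big[of 0]) (auto simp: U_def p1 add_subgroupD[OF H(2)] simp flip: add.assoc)
  have bV: "?k \<le> card V"
    using x by (intro big[of 0]) (auto simp: V_def p2 add_subgroupD[OF H(1)] simp flip: add.assoc)
  have bU': "?k \<le> card U'" if ne: "U' \<noteq> {}"
  proof -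
    obtain h where "h \<in> U'" using ne by auto
    then show ?thesis
      by (rule big) (auto simp: U'_def p1 add_subgroupD[OF H(2)] simp flip: add.assoc)
  qed
  have bV': "?k \<le> card V'" if ne: "V' \<noteq> {}"
  proof -
    obtain h where "h \<in> V'" using ne by auto
    then show ?thesis
      by (rule big) (auto simp: V'_def p2 add_subgroupD[OF H(1)] simp flip: add.assoc)
  qed
  have sU: "card H2 = card U + card U'"
  proof -
    have "H2 = U \<union> U'" "U \<inter> U' = {}" by (auto simp: U_def U'_def)
    then show ?thesis by (simp add: card_Un_disjoint)
  qed
  have sV: "card H1 = card V + card V'"
  proof -
    have "H1 = V \<union> V'" "V \<inter> V' = {}" by (auto simp: V_def V'_def)
    then show ?thesis by (simp add: card_Un_disjoint)
  qed
  consider "U' = {}" | "V' = {}" | "U' \<noteq> {}" "V' \<noteq> {}" by blast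
  then show ?thesis
  proof cases
    case 1
    then have "card H2 * ?k \<le> card (C1 - C2) * ?k"
      using order_trans[OF mult_le_mono2[OF bV] e1] sU by simp
    then show ?thesis using kpos by simp
  next
    case 2
    then have "card H1 * ?k \<le> card (C1 - C2) * ?k"
      using order_trans[OF mult_le_mono1[OF bU] e1] sV by (simp add: mult.commute)
    then show ?thesis using kpos by simp
  next
    case 3
    show ?thesis
    proof (rule ccontr)
      assume "\<not> ?thesis"
      then have n: "card (C1 - C2) + ?k < card U + card U'" "card (C2 - C1) + ?k < card V + card V'"
        using sU sV by auto
      \<comment> \<open>Each product bound, combined with one negated alternative, compares
        \<open>v\<close> with \<open>u'\<close>: the first gives \<open>v < u'\<close>, the second
        \<open>u' < v\<close>.\<close>
      define u u' v v' k where d: "u = int (card U)" "u' = int (card U')" "v = int (card V)"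
        "v' = int (card V')" "k = int ?k"
      have b: "k \<le> u" "k \<le> v" "k \<le> u'" "k \<le> v'" "0 < k"
        using bU bV bU'[OF 3(1)] bV'[OF 3(2)] kpos by (auto simp: d)
      have "u * v \<le> int (card (C1 - C2)) * k" using e1 unfolding d by (metis of_nat_le_iff of_nat_mult)
      also have "\<dots> < (u + u' - k) * k" using n(1) b by (intro mult_strict_right_mono) (auto simp: d)
      finally have "u * (v - k) < k * (u' - k)" by (simp add: algebra_simps)
      moreover have "k * (v - k) \<le> u * (v - k)" using b by (intro mult_right_mono) auto
      ultimately have "k * (v - k) < k * (u' - k)" by simp
      then have 1: "v < u'" using b by simp
      have "u' * v' \<le> int (card (C2 - C1)) * k" using e2 unfolding d by (metis of_nat_le_iff of_nat_mult)
      also have "\<dots> < (v + v' - k) * k" using n(2) b by (intro mult_strict_right_mono) (auto simp: d)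
      finally have "v' * (u' - k) < k * (v - k)" by (simp add: algebra_simps)
      moreover have "k * (u' - k) \<le> v' * (u' - k)" using b by (intro mult_right_mono) auto
      ultimately have "k * (u' - k) < k * (v - k)" by simp
      then show False using 1 b by simp
    qed
  qed
qed

lemma card_union_period:
  fixes C1 C2 :: "'a::{ab_group_add, finite} set"
  assumes "N \<le> card C1 + card (period C1)" "N \<le> card C2 + card (period C2)"
  shows "N \<le> card (C1 \<union> C2) + card (period (C1 \<union> C2))"
proof (cases "C1 \<subseteq> C2 \<or> C2 \<subseteq> C1")
  case True
  then show ?thesis using assms by (auto simp: Un_absorb1 Un_absorb2)
next
  case False
  then obtain x y where xy: "x \<in> C1 - C2" "y \<in> C2 - C1" by auto
  have "period C1 \<inter> period C2 \<subseteq> period (C1 \<union> C2)" by (auto simp: mem_period_iff)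
  then have k: "card (period C1 \<inter> period C2) \<le> card (period (C1 \<union> C2))" by (simp add: card_mono)
  have "card (C1 \<union> C2) = card (C1 \<union> (C2 - C1))" by simp
  also have "\<dots> = card C1 + card (C2 - C1)" by (rule card_Un_disjoint) auto
  finally have u1: "card (C1 \<union> C2) = card C1 + card (C2 - C1)" .
  have "card (C1 \<union> C2) = card (C2 \<union> (C1 - C2))" by (simp add: Un_commute)
  also have "\<dots> = card C2 + card (C1 - C2)" by (rule card_Un_disjoint) auto
  finally have u2: "card (C1 \<union> C2) = card C2 + card (C1 - C2)" .
  \<comment> \<open>If only the first alternative holds for both \<open>x\<close> and
    \<open>y\<close>, each period is at most the difference on its own side, and the smaller of the
    two periods is then covered by the growth of the union.\<close>
  show ?thesis
    using union_period_aux[OF xy(1)] union_period_aux[OF xy(2)] k u1 u2 assms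
    by (auto simp: Int_commute)
qed

lemma card_Union_period:
  fixes F :: "'a::{ab_group_add, finite} set set"
  assumes "F \<noteq> {}" "\<And>C. C \<in> F \<Longrightarrow> N \<le> card C + card (period C)"
  shows "N \<le> card (\<Union>F) + card (period (\<Union>F))"
  using finite[of F] assms
proof (induction F rule: finite_ne_induct)
  case (insert C F)
  then show ?case using card_union_period[of N C "\<Union>F"] by simp
qed simp

text \<open>Dyson's e-transform, applied with shifts that keep \<open>a + b\<close> in the sumset.\<close>

lemma ex_large_subset_of_sumset:
  fixes A B :: "'a::{ab_group_add, finite} set"
  assumes "a \<in> A" "b \<in> B"
  shows "\<exists>C. a + b \<in> C \<and> C \<subseteq> A + B \<and> card A + card B \<le> card C + card (period C)"
  using assms
proof (induction "card B" arbitrary: A B rule: less_induct)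
  case less
  show ?case
  proof (cases "\<forall>a'\<in>A. \<forall>y\<in>B. a' + (y - b) \<in> A")
    case True
    then have "(+) (- b) ` B \<subseteq> period A" by (auto simp: mem_period_iff)
    then have "card B \<le> card (period A)" by (metis card_mono card_translate finite)
    moreover have "(+) b ` A \<subseteq> A + B" using less.prems(2) by (auto simp: add.commute intro: set_plus_intro)
    moreover have "a + b \<in> (+) b ` A" using less.prems(1) by (auto simp: add.commute)
    ultimately show ?thesis by (intro exI[of _ "(+) b ` A"]) (simp add: period_translate)
  next
    case False
    then obtain a' y where ay: "a' \<in> A" "y \<in> B" "a' + (y - b) \<notin> A" by auto
    \<comment> \<open>The shift is \<open>e = a' - b\<close>: \<open>b\<close> stays in
      \<open>B'\<close> because \<open>b + e = a'\<close> lies in \<open>A\<close>, while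
      \<open>y\<close> leaves it because \<open>y + e\<close> does not. So \<open>B'\<close> is
      smaller and still contains \<open>b\<close>.\<close>
    define A' where "A' = A \<union> (+) (a' - b) ` B"
    define B' where "B' = {x\<in>B. x + (a' - b) \<in> A}"
    have "card B' < card B"
      using ay by (intro psubset_card_mono) (auto simp: B'_def algebra_simps)
    moreover have "a \<in> A'" using less.prems by (simp add: A'_def)
    moreover have "b \<in> B'" using less.prems ay by (simp add: B'_def)
    ultimately obtain C where C: "a + b \<in> C" "C \<subseteq> A' + B'" "card A' + card B' \<le> card C + card (period C)"
      using less.hyps by blast
    have "A' + B' \<subseteq> A + B"
    proof
      fix z assume "z \<in> A' + B'"
      then obtain p q where z: "z = p + q" "p \<in> A'" "q \<in> B'" by (auto elim: set_plus_elim)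
      show "z \<in> A + B"
      proof (cases "p \<in> A")
        case True
        then show ?thesis using z by (auto simp: B'_def intro: set_plus_intro)
      next
        case False
        then obtain y where "y \<in> B" "p = a' - b + y" using z by (auto simp: A'_def)
        then have "z = (q + (a' - b)) + y" using z by (simp add: algebra_simps)
        moreover have "q + (a' - b) \<in> A" using z by (simp add: B'_def)
        ultimately show ?thesis using set_plus_intro \<open>y \<in> B\<close> by blast
      qed
    qed
    moreover have "card A + card B = card A' + card B'"
    proof -
      have "(+) (a' - b) ` B' = A \<inter> (+) (a' - b) ` B"
        by (auto simp: B'_def image_iff add.commute)
      then have "card B' = card (A \<inter> (+) (a' - b) ` B)" by (metis card_translate)
      then show ?thesis using card_Un_Int[of A "(+) (a' - b) ` B"] by (simp add: A'_def)
    qed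
    ultimately show ?thesis using C by (intro exI[of _ C]) auto
  qed
qed

text \<open>Each sum lies in some set of the preceding lemma; the union of all such sets is
  \<open>A + B\<close> and inherits their inequality. The sharper form, with the saturated summands
  \<open>A + H\<close> and \<open>B + H\<close> on the left, follows by applying this one to them,
  as in \<open>sumset_hull\<close>.\<close>

theorem kneser:
  fixes A B :: "'a::{ab_group_add, finite} set"
  assumes "A \<noteq> {}" "B \<noteq> {}"
  shows "card A + card B \<le> card (A + B) + card (period (A + B))"
proof -
  define F where "F = {C. C \<subseteq> A + B \<and> card A + card B \<le> card C + card (period C)}"
  have "c \<in> \<Union>F" if "c \<in> A + B" for c
    using that
  proof (rule set_plus_elim)
    fix a b assume "c = a + b" "a \<in> A" "b \<in> B"
    then show ?thesis using ex_large_subset_of_sumset[of a A b B] by (auto simp: F_def)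
  qed
  then have U: "\<Union>F = A + B" by (auto simp: F_def)
  have "A + B \<noteq> {}" using assms by (auto simp: set_plus_def)
  then have "F \<noteq> {}" using U by auto
  then show ?thesis using card_Union_period[of F] U by (auto simp: F_def)
qed

section \<open>Sumsets and diameters\<close>

lemma add_subgroup_gen_subgroup: "add_subgroup (gen_subgroup A)"
  unfolding gen_subgroup_def add_subgroup_def by simp

lemma subset_gen_subgroup: "A \<subseteq> gen_subgroup A"
  unfolding gen_subgroup_def by blast

lemma gen_subgroup_least: "add_subgroup H \<Longrightarrow> A \<subseteq> H \<Longrightarrow> gen_subgroup A \<subseteq> H"
  unfolding gen_subgroup_def by blast

lemma gen_subgroup_mono: "A \<subseteq> B \<Longrightarrow> gen_subgroup A \<subseteq> gen_subgroup B"
  unfolding gen_subgroup_def by blast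

lemma gen_subgroup_eq_UNIV_iff:
  "gen_subgroup A = UNIV \<longleftrightarrow> (\<forall>H. add_subgroup H \<longrightarrow> A \<subseteq> H \<longrightarrow> H = UNIV)"
proof
  assume "gen_subgroup A = UNIV"
  then show "\<forall>H. add_subgroup H \<longrightarrow> A \<subseteq> H \<longrightarrow> H = UNIV" using gen_subgroup_least[of _ A] by auto
qed (simp add: add_subgroup_gen_subgroup subset_gen_subgroup)

lemma gen_subgroup_insert_0 [simp]: "gen_subgroup (insert 0 A) = gen_subgroup A"
proof -
  have "add_subgroup H \<and> insert 0 A \<subseteq> H \<longleftrightarrow> add_subgroup H \<and> A \<subseteq> H" for H
    using add_subgroupD(1) by auto
  then show ?thesis by (simp only: gen_subgroup_def)
qed

lemma rho_sumset_0 [simp]: "rho_sumset A 0 = {0}"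
  by (auto simp: rho_sumset_def)

lemma rho_sumset_Suc: "rho_sumset A (Suc r) = insert 0 A + rho_sumset A r"
proof
  show "rho_sumset A (Suc r) \<subseteq> insert 0 A + rho_sumset A r"
  proof
    fix x assume "x \<in> rho_sumset A (Suc r)"
    then obtain xs where xs: "x = sum_list xs" "length xs = Suc r" "set xs \<subseteq> insert 0 A"
      by (auto simp: rho_sumset_def)
    then obtain y ys where "xs = y # ys" by (cases xs) auto
    then show "x \<in> insert 0 A + rho_sumset A r"
      using xs by (auto simp: rho_sumset_def intro!: set_plus_intro)
  qed
  show "insert 0 A + rho_sumset A r \<subseteq> rho_sumset A (Suc r)"
  proof
    fix x assume "x \<in> insert 0 A + rho_sumset A r"
    then obtain y xs where "x = y + sum_list xs" "y \<in> insert 0 A" "length xs = r" "set xs \<subseteq> insert 0 A"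
      by (auto elim!: set_plus_elim simp: rho_sumset_def)
    then show "x \<in> rho_sumset A (Suc r)"
      unfolding rho_sumset_def by (intro CollectI exI[of _ "y # xs"]) auto
  qed
qed

lemma rho_sumset_3: "rho_sumset A 3 = insert 0 A + insert 0 A + insert 0 A"
proof -
  have "insert 0 A + {0} = insert 0 A" by (auto simp: set_plus_def)
  then show ?thesis by (simp add: numeral_3_eq_3 rho_sumset_Suc add.assoc)
qed

lemma rho_sumset_Suc_mono: "rho_sumset A r \<subseteq> rho_sumset A (Suc r)"
  using set_plus_intro[of 0 "insert 0 A"] by (auto simp: rho_sumset_Suc)

lemma rho_sumset_mono: "r \<le> s \<Longrightarrow> rho_sumset A r \<subseteq> rho_sumset A s"
  using rho_sumset_Suc_mono by (rule lift_Suc_mono_le[where f = "rho_sumset A"])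

lemma zero_mem_rho_sumset: "0 \<in> rho_sumset A r"
  using rho_sumset_mono[of 0 r A] by auto

lemma rho_sumset_subset_gen: "rho_sumset A r \<subseteq> gen_subgroup A"
proof (induction r)
  case 0
  then show ?case using add_subgroupD(1)[OF add_subgroup_gen_subgroup] by auto
next
  case (Suc r)
  then show ?case
    using add_subgroupD(1,2)[OF add_subgroup_gen_subgroup[of A]] subset_gen_subgroup[of A]
    by (auto simp: rho_sumset_Suc elim!: set_plus_elim)
qed

text \<open>A sumset that stops growing is invariant under \<open>A\<close>, so its period is the
  whole group; and it contains 0.\<close>

lemma rho_sumset_stable:
  fixes A :: "'a::{ab_group_add, finite} set"
  assumes "rho_sumset A (Suc r) = rho_sumset A r" "gen_subgroup A = UNIV"
  shows "rho_sumset A r = UNIV"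
proof -
  have "A \<subseteq> period (rho_sumset A r)"
    using assms(1) set_plus_intro[of _ "insert 0 A" _ "rho_sumset A r"]
    by (auto simp: mem_period_iff rho_sumset_Suc add.commute)
  then have "period (rho_sumset A r) = UNIV"
    using assms(2) add_subgroup_period gen_subgroup_eq_UNIV_iff by blast
  then have "0 + g \<in> rho_sumset A r" for g
    using zero_mem_rho_sumset[of A r] by (metis UNIV_I mem_period_iff)
  then show ?thesis by auto
qed

text \<open>Starting from one element, the sumsets gain at least one element per step until they
  fill the group.\<close>

lemma rho_sumset_card_minus_1:
  fixes A :: "'a::{ab_group_add, finite} set"
  assumes gen: "gen_subgroup A = UNIV"
  shows "rho_sumset A (card (UNIV :: 'a set) - 1) = UNIV"
proof -
  have "rho_sumset A r = UNIV \<or> r < card (rho_sumset A r)" for r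
  proof (induction r)
    case (Suc r)
    show ?case
    proof (cases "rho_sumset A (Suc r) = rho_sumset A r")
      case True
      then show ?thesis using rho_sumset_stable[OF _ gen] by simp
    next
      case False
      then have "card (rho_sumset A r) < card (rho_sumset A (Suc r))"
        using rho_sumset_Suc_mono[of A r] by (intro psubset_card_mono) auto
      then show ?thesis using Suc rho_sumset_Suc_mono[of A r] by auto
    qed
  qed simp
  from this[of "card (UNIV :: 'a set) - 1"] show ?thesis
  proof
    assume "card (UNIV :: 'a set) - 1 < card (rho_sumset A (card (UNIV :: 'a set) - 1))"
    then have "card (UNIV :: 'a set) \<le> card (rho_sumset A (card (UNIV :: 'a set) - 1))" by simp
    then show ?thesis by (meson card_seteq finite subset_UNIV)
  qed
qed

lemma diamA_less_infinity_iff: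
  fixes A :: "'a::{ab_group_add, finite} set"
  shows "diamA A < \<infinity> \<longleftrightarrow> gen_subgroup A = UNIV"
proof
  assume "diamA A < \<infinity>"
  then show "gen_subgroup A = UNIV"
    using rho_sumset_subset_gen[of A] by (fastforce simp: diamA_def split: if_splits)
next
  assume "gen_subgroup A = UNIV"
  then show "diamA A < \<infinity>" using rho_sumset_card_minus_1[of A] by (auto simp: diamA_def)
qed

lemma four_le_diamA_iff: "enat 4 \<le> diamA A \<longleftrightarrow> insert 0 A + insert 0 A + insert 0 A \<noteq> UNIV"
proof (cases "\<exists>r. rho_sumset A r = UNIV")
  case True
  define L where "L = (LEAST r. rho_sumset A r = UNIV)"
  have L: "rho_sumset A L = UNIV" using True unfolding L_def by (metis (mono_tags) LeastI)
  have "enat 4 \<le> diamA A \<longleftrightarrow> 4 \<le> L" using True by (simp add: diamA_def L_def)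
  also have "\<dots> \<longleftrightarrow> rho_sumset A 3 \<noteq> UNIV"
  proof
    assume "4 \<le> L"
    then show "rho_sumset A 3 \<noteq> UNIV"
      using not_less_Least[of 3 "\<lambda>r. rho_sumset A r = UNIV"] by (simp add: L_def)
  next
    assume "rho_sumset A 3 \<noteq> UNIV"
    then show "4 \<le> L" using L rho_sumset_mono[of L 3 A] by (cases "L \<le> 3") auto
  qed
  finally show ?thesis by (simp add: rho_sumset_3)
next
  case False
  then show ?thesis by (simp add: diamA_def flip: rho_sumset_3)
qed

text \<open>This is the form in which the diameter hypothesis enters. It excludes the orders 3 and
  4, for which the constructions below degenerate.\<close>

lemma card_ge_5:
  assumes "4 \<le> diam (G :: 'a::{ab_group_add, finite} itself)"
  shows "5 \<le> card (UNIV :: 'a set)"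
proof (rule ccontr)
  assume "\<not> ?thesis"
  then have "diamA A \<le> 3" if "gen_subgroup A = UNIV" for A :: "'a set"
    using rho_sumset_card_minus_1[OF that] Least_le[of "\<lambda>r. rho_sumset A r = UNIV" "card (UNIV :: 'a set) - 1"]
    by (auto simp: diamA_def numeral_eq_enat)
  then have "diam G \<le> 3" unfolding diam_def by (auto intro: Sup_least)
  then show False using order_trans[OF assms] by fastforce
qed

section \<open>Lagrange's theorem and exponents of quotients\<close>

lemma nsmul_card: "(\<Sum>x\<in>A. (g::'a::ab_group_add)) = nsmul (card A) g" if "finite A"
  using that by (induction A rule: finite_induct) auto

text \<open>Translation by \<open>g\<close> permutes the group, so it leaves the sum of all elements
  fixed while adding \<open>g\<close> once per element.\<close>

lemma nsmul_order [simp]: "nsmul (card (UNIV :: 'a set)) (g :: 'a::{ab_group_add, finite}) = 0"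
proof -
  have "(\<Sum>x\<in>UNIV. x) = (\<Sum>x\<in>UNIV. g + x)"
    by (rule sum.reindex_bij_witness[of _ "\<lambda>x. g + x" "\<lambda>x. x - g"]) auto
  also have "\<dots> = nsmul (card (UNIV :: 'a set)) g + (\<Sum>x\<in>UNIV. x)"
    by (simp add: sum.distrib nsmul_card del: sum_constant)
  finally show ?thesis by simp
qed

text \<open>A proper \<open>H\<close> excludes exponent 1; afterwards only the condition on doubles
  is used.\<close>

lemma exp_quot_eq_2_iff:
  fixes H :: "'a::{ab_group_add, finite} set"
  assumes "add_subgroup H" "H \<noteq> UNIV"
  shows "exp_quot H = 2 \<longleftrightarrow> (\<forall>g. g + g \<in> H)"
proof -
  let ?P = "\<lambda>n. 0 < n \<and> (\<forall>g::'a. nsmul n g \<in> H)"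
  have "?P (card (UNIV :: 'a set))"
    using add_subgroupD(1)[OF assms(1)] by (simp add: card_gt_0_iff)
  then have L: "?P (exp_quot H)" unfolding exp_quot_def by (rule LeastI)
  show ?thesis
  proof
    assume "exp_quot H = 2"
    then show "\<forall>g. g + g \<in> H" using L by (simp add: nsmul_two)
  next
    assume "\<forall>g. g + g \<in> H"
    then have "exp_quot H \<le> 2" unfolding exp_quot_def by (intro Least_le) (simp add: nsmul_two)
    moreover have "exp_quot H \<noteq> 1" using L assms(2) by (metis UNIV_eq_I nsmul_one)
    ultimately show "exp_quot H = 2" using L by linarith
  qed
qed

section \<open>The upper bound\<close>

lemma ex_maximal_subgroup:
  fixes H :: "'a::{ab_group_add, finite} set"
  assumes "add_subgroup H" "P H"
  obtains K where "add_subgroup K" "H \<subseteq> K" "P K" "\<And>L. add_subgroup L \<Longrightarrow> K \<subset> L \<Longrightarrow> \<not> P L"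
proof -
  have "\<exists>K\<in>{K. add_subgroup K \<and> P K}. H \<le> K \<and> (\<forall>L\<in>{K. add_subgroup K \<and> P K}. K \<le> L \<longrightarrow> K = L)"
    by (rule finite_has_maximal2) (use assms in auto)
  then obtain K where K: "K \<in> {K. add_subgroup K \<and> P K}"
    and m: "H \<le> K \<and> (\<forall>L\<in>{K. add_subgroup K \<and> P K}. K \<le> L \<longrightarrow> K = L)" ..
  show ?thesis
  proof (rule that)
    show "add_subgroup K" "H \<subseteq> K" "P K" using K m by simp_all
    fix L assume L: "add_subgroup L" "K \<subset> L"
    show "\<not> P L"
    proof
      assume "P L"
      then have "L \<in> {K. add_subgroup K \<and> P K}" using L by simp
      then have "K = L" using bspec[OF conjunct2[OF m]] L(2) by (metis psubsetE)
      then show False using L(2) by simp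
    qed
  qed
qed

text \<open>Take \<open>K\<close> maximal among the subgroups above \<open>H\<close> that miss
  \<open>x\<close>. Adjoining any \<open>y\<close> outside \<open>K\<close> must catch
  \<open>x\<close>, so \<open>x - y\<close> lies in \<open>K\<close>: the index is 2, and the
  character is the sign that is 1 exactly on \<open>K\<close>.\<close>

lemma ex_sign_character:
  fixes H :: "'a::{ab_group_add, finite} set"
  assumes H: "add_subgroup H" and sq: "\<And>g. g + g \<in> H" and x: "x \<notin> H"
  shows "\<exists>\<chi>::'a \<Rightarrow> int. (\<forall>a b. \<chi> (a + b) = \<chi> a * \<chi> b) \<and> (\<forall>h\<in>H. \<chi> h = 1) \<and> \<chi> x = -1"
proof -
  obtain K where K: "add_subgroup K" "H \<subseteq> K" "x \<notin> K" "\<And>L. add_subgroup L \<Longrightarrow> K \<subset> L \<Longrightarrow> x \<in> L"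
    by (rule ex_maximal_subgroup[of H "\<lambda>K. x \<notin> K", OF H x]) auto
  note cancel = add_subgroup_add_cancel[OF K(1)]
  have d: "x - y \<in> K" if "y \<notin> K" for y
  proof -
    have "add_subgroup (K \<union> (+) y ` K)"
    proof (rule add_subgroup_finiteI)
      fix a b assume "a \<in> K \<union> (+) y ` K" "b \<in> K \<union> (+) y ` K"
      then have "a \<in> K \<or> a - y \<in> K" "b \<in> K \<or> b - y \<in> K" by (auto simp: mem_coset_iff)
      moreover have "a + b = (a - y) + (b - y) + (y + y)" "a + b - y = a + (b - y)" "a + b - y = (a - y) + b"
        by simp_all
      moreover have "y + y \<in> K" using sq K(2) by blast
      ultimately have "a + b \<in> K \<or> a + b - y \<in> K"
        using add_subgroupD(2)[OF K(1)] by metis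
      then show "a + b \<in> K \<union> (+) y ` K" by (auto simp: mem_coset_iff)
    qed (use add_subgroupD(1)[OF K(1)] in auto)
    moreover have "y \<in> (+) y ` K" using add_subgroupD(1)[OF K(1)] by (auto simp: mem_coset_iff)
    ultimately have "x \<in> K \<union> (+) y ` K" using K(4)[of "K \<union> (+) y ` K"] that by blast
    then show ?thesis using K(3) by (auto simp: mem_coset_iff)
  qed
  have both: "a + b \<in> K" if "a \<notin> K" "b \<notin> K" for a b
  proof -
    have "a + b = (x + x) - (x - a) - (x - b)" by simp
    moreover have "x + x \<in> K" using sq K(2) by blast
    ultimately show ?thesis using d that add_subgroupD(4)[OF K(1)] by metis
  qed
  show ?thesis
    using K both by (intro exI[of _ "\<lambda>y. if y \<in> K then 1 else -1"]) (auto simp: cancel)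
qed

text \<open>A weak form of a theorem of Davydov and Tombak: a sum-free set of density above \<open>1/3\<close> in an
  elementary abelian 2-group lies outside a hyperplane. The counting weighs the squared Fourier
  coefficients \<open>f \<chi>\<close> with the factor \<open>2 * f \<chi> + n - 2 * s\<close>, which has to be negative for some
  non-trivial character.\<close>

lemma large_sum_free_mod_2:
  fixes H S :: "'a::{ab_group_add, finite} set"
  defines "n \<equiv> card (UNIV :: 'a set)"
  assumes H: "add_subgroup H" and sq: "\<And>g. g + g \<in> H" and per: "H \<subseteq> period S"
    and free: "\<And>a b c. a \<in> S \<Longrightarrow> b \<in> S \<Longrightarrow> c \<in> S \<Longrightarrow> a + b + c \<notin> H" and big: "n < 3 * card S"
  shows "\<exists>\<chi>::'a \<Rightarrow> int. (\<forall>a b. \<chi> (a + b) = \<chi> a * \<chi> b) \<and> (\<forall>a\<in>S. \<chi> a = -1)"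
proof -
  define X where "X = {\<chi>::'a \<Rightarrow> int. (\<forall>a b. \<chi> (a + b) = \<chi> a * \<chi> b) \<and> (\<forall>h\<in>H. \<chi> h = 1)}"
  define M where "M = int (card X)"
  define s where "s = int (card S)"
  define f where "f \<chi> = (\<Sum>a\<in>S. \<chi> a)" for \<chi> :: "'a \<Rightarrow> int"
  have mult: "\<chi> (a + b) = \<chi> a * \<chi> b" if "\<chi> \<in> X" for \<chi> a b using that by (simp add: X_def)
  have sgn: "\<chi> a = 1 \<or> \<chi> a = -1" if "\<chi> \<in> X" for \<chi> a
  proof -
    have "\<chi> a * \<chi> a = 1" using mult[OF that, of a a] sq[of a] that by (auto simp: X_def)
    then show ?thesis by (auto simp: zmult_eq_1_iff)
  qed
  have "inj_on (\<lambda>\<chi>. {a. \<chi> a = 1}) X"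
  proof (rule inj_onI, rule ext)
    fix \<chi> \<psi> a assume a: "\<chi> \<in> X" "\<psi> \<in> X" "{a. \<chi> a = 1} = {a. \<psi> a = 1}"
    then have "\<chi> a = 1 \<longleftrightarrow> \<psi> a = 1" by blast
    then show "\<chi> a = \<psi> a" using sgn[OF a(1), of a] sgn[OF a(2), of a] by auto
  qed
  then have finX: "finite X" by (rule inj_on_finite[of _ _ UNIV]) auto
  have one: "(\<lambda>_. 1) \<in> X" by (simp add: X_def)
  have orth: "(\<Sum>\<chi>\<in>X. \<chi> a) = (if a \<in> H then M else 0)" for a
  proof (cases "a \<in> H")
    case True
    then show ?thesis by (simp add: X_def M_def)
  next
    case False
    then obtain \<psi> where p: "\<psi> \<in> X" "\<psi> a = -1"
      using ex_sign_character[OF H sq] unfolding X_def by blast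
    have inv: "\<psi> b * \<psi> b = 1" for b using sgn[OF p(1), of b] by auto
    have "(\<Sum>\<chi>\<in>X. \<chi> a) = (\<Sum>\<chi>\<in>X. \<psi> a * \<chi> a)"
      by (rule sum.reindex_bij_witness[of _ "\<lambda>\<chi> b. \<psi> b * \<chi> b" "\<lambda>\<chi> b. \<psi> b * \<chi> b"])
        (use p in \<open>auto simp: X_def mult.assoc[symmetric] inv\<close>)
    then show ?thesis using p(2) False by (simp add: sum_negf)
  qed
  have dual: "(\<Sum>a\<in>UNIV. \<chi> a) = (if \<chi> = (\<lambda>_. 1) then int n else 0)" if c: "\<chi> \<in> X" for \<chi>
  proof (cases "\<chi> = (\<lambda>_. 1)")
    case False
    then obtain b where b: "\<chi> b = -1" using sgn[OF c] by blast
    have "(\<Sum>a\<in>UNIV. \<chi> a) = (\<Sum>a\<in>UNIV. \<chi> (b + a))"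
      by (rule sum.reindex_bij_witness[of _ "\<lambda>x. b + x" "\<lambda>x. x - b"]) auto
    then show ?thesis using False by (simp add: mult[OF c] b sum_negf)
  qed (simp add: n_def)
  have MH: "M * int (card H) = int n"
  proof -
    have "M * int (card H) = (\<Sum>a\<in>UNIV. \<Sum>\<chi>\<in>X. \<chi> a)" by (simp add: orth sum.If_cases)
    also have "\<dots> = (\<Sum>\<chi>\<in>X. \<Sum>a\<in>UNIV. \<chi> a)" by (rule sum.swap)
    also have "\<dots> = int n" using one finX by (simp add: dual)
    finally show ?thesis .
  qed
  \<comment> \<open>Up to the factor \<open>M\<close>, the third moment counts triples of
    \<open>S\<close> with sum in \<open>H\<close>; there are none.\<close>
  have cube: "(\<Sum>\<chi>\<in>X. f \<chi> ^ 3) = 0"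
  proof -
    have "(\<Sum>\<chi>\<in>X. f \<chi> ^ 3) = (\<Sum>\<chi>\<in>X. \<Sum>a\<in>S. \<Sum>b\<in>S. \<Sum>c\<in>S. \<chi> (a + b + c))"
    proof (rule sum.cong[OF refl])
      fix \<chi> assume "\<chi> \<in> X"
      have "f \<chi> ^ 3 = (\<Sum>a\<in>S. \<chi> a) * (\<Sum>b\<in>S. \<Sum>c\<in>S. \<chi> b * \<chi> c)"
        by (simp add: f_def power3_eq_cube mult.assoc flip: sum_product)
      also have "\<dots> = (\<Sum>a\<in>S. \<chi> a * (\<Sum>b\<in>S. \<Sum>c\<in>S. \<chi> b * \<chi> c))" by (rule sum_distrib_right)
      also have "\<dots> = (\<Sum>a\<in>S. \<Sum>b\<in>S. \<Sum>c\<in>S. \<chi> (a + b + c))"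
        by (simp add: mult[OF \<open>\<chi> \<in> X\<close>] sum_distrib_left mult.assoc)
      finally show "f \<chi> ^ 3 = (\<Sum>a\<in>S. \<Sum>b\<in>S. \<Sum>c\<in>S. \<chi> (a + b + c))" .
    qed
    also have "\<dots> = (\<Sum>a\<in>S. \<Sum>b\<in>S. \<Sum>c\<in>S. \<Sum>\<chi>\<in>X. \<chi> (a + b + c))"
      by (rule trans[OF sum.swap], rule sum.cong[OF refl], rule trans[OF sum.swap], rule sum.cong[OF refl], rule sum.swap)
    also have "\<dots> = 0" by (simp add: orth free)
    finally show ?thesis .
  qed
  \<comment> \<open>Since \<open>a + a\<close> lies in \<open>H\<close>, the partners
    \<open>b\<close> of \<open>a\<close> with \<open>a + b\<close> in \<open>H\<close> form the
    coset of \<open>a\<close>, which periodicity keeps inside \<open>S\<close>.\<close>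
  have square: "(\<Sum>\<chi>\<in>X. f \<chi> ^ 2) = s * int n"
  proof -
    have "(\<Sum>\<chi>\<in>X. f \<chi> ^ 2) = (\<Sum>\<chi>\<in>X. \<Sum>a\<in>S. \<Sum>b\<in>S. \<chi> (a + b))"
      by (intro sum.cong refl) (simp add: f_def mult power2_eq_square sum_product)
    also have "\<dots> = (\<Sum>a\<in>S. \<Sum>b\<in>S. \<Sum>\<chi>\<in>X. \<chi> (a + b))"
      by (rule trans[OF sum.swap], rule sum.cong[OF refl], rule sum.swap)
    also have "\<dots> = (\<Sum>a\<in>S. int n)"
    proof (rule sum.cong[OF refl])
      fix a assume a: "a \<in> S"
      have "S \<inter> {b. a + b \<in> H} = (+) a ` H"
      proof -
        have "b - a \<in> H \<longleftrightarrow> a + b \<in> H" for b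
          using add_subgroup_add_cancel(1)[OF H sq[of a], of "b - a"] by (simp add: add.commute)
        moreover have "b \<in> S" if "b - a \<in> H" for b
          using per a that by (auto simp: subgroup_le_period_iff dest!: bspec)
        ultimately show ?thesis unfolding set_eq_iff mem_coset_iff by auto
      qed
      then have "card (S \<inter> {b. a + b \<in> H}) = card H" by (simp only: card_translate)
      moreover have "(\<Sum>b\<in>S. \<Sum>\<chi>\<in>X. \<chi> (a + b)) = int (card (S \<inter> {b. a + b \<in> H})) * M"
        by (simp only: orth sum.If_cases[OF finite]) simp
      ultimately show "(\<Sum>b\<in>S. \<Sum>\<chi>\<in>X. \<chi> (a + b)) = int n" using MH by (simp only: mult.commute)
    qed
    finally show ?thesis by (simp add: s_def)
  qed
  have f1: "f (\<lambda>_. 1) = s" by (simp add: f_def s_def)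
  \<comment> \<open>For non-trivial characters the weight equals
    \<open>n - 4 * card {a\<in>S. \<chi> a = -1}\<close>, so it is negative iff \<open>S\<close>
    contains more than half of the set where the character is -1. At the trivial character the
    weight is \<open>n\<close>; removing that term leaves the total
    \<open>s * n * (n - 3 * s)\<close>, negative by density.\<close>
  have "\<exists>\<chi>\<in>X - {\<lambda>_. 1}. 2 * f \<chi> + int n - 2 * s < 0"
  proof (rule ccontr)
    assume "\<not> ?thesis"
    then have "0 \<le> (\<Sum>\<chi>\<in>X - {\<lambda>_. 1}. f \<chi> ^ 2 * (2 * f \<chi> + int n - 2 * s))"
      by (intro sum_nonneg mult_nonneg_nonneg) (auto simp: not_less)
    also have "\<dots> = (\<Sum>\<chi>\<in>X. f \<chi> ^ 2 * (2 * f \<chi> + int n - 2 * s)) - s ^ 2 * int n"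
      using finX one by (simp add: sum_diff1 f1)
    also have "(\<Sum>\<chi>\<in>X. f \<chi> ^ 2 * (2 * f \<chi> + int n - 2 * s))
        = 2 * (\<Sum>\<chi>\<in>X. f \<chi> ^ 3) + (int n - 2 * s) * (\<Sum>\<chi>\<in>X. f \<chi> ^ 2)"
      by (simp add: sum_distrib_left sum.distrib[symmetric] algebra_simps power2_eq_square power3_eq_cube)
    also have "\<dots> - s ^ 2 * int n = s * int n * (int n - 3 * s)"
      unfolding cube square by (simp add: algebra_simps power2_eq_square)
    finally have "0 \<le> s * int n * (int n - 3 * s)" .
    moreover have "int n - 3 * s < 0" using big by (simp add: s_def)
    moreover have "0 < int n" by (simp add: n_def card_gt_0_iff)
    ultimately have "s * int n * (int n - 3 * s) < 0" by (intro mult_pos_neg mult_pos_pos) auto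
    then show False using \<open>0 \<le> s * int n * (int n - 3 * s)\<close> by simp
  qed
  then obtain \<chi> where \<chi>: "\<chi> \<in> X - {\<lambda>_. 1}" and c3: "2 * f \<chi> + int n - 2 * s < 0" ..
  have c: "\<chi> \<in> X" "\<chi> \<noteq> (\<lambda>_. 1)" using \<chi> by simp_all
  have count: "(\<Sum>a\<in>A. \<chi> a) = int (card A) - 2 * int (card {a\<in>A. \<chi> a = -1})" for A
  proof -
    have "(\<Sum>a\<in>A. \<chi> a) = (\<Sum>a\<in>A. 1 - (if \<chi> a = -1 then 2 else 0))"
    proof (rule sum.cong[OF refl])
      fix a show "\<chi> a = 1 - (if \<chi> a = -1 then 2 else 0)" using sgn[OF c(1), of a] by auto
    qed
    also have "\<dots> = int (card A) - 2 * int (card {a\<in>A. \<chi> a = -1})"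
      by (simp add: sum_subtractf sum.If_cases Int_def mult.commute)
    finally show ?thesis .
  qed
  define T where "T = {a. \<chi> a = -1}"
  define S1 where "S1 = {a\<in>S. \<chi> a = -1}"
  have "(\<Sum>a\<in>UNIV. \<chi> a) = 0" unfolding dual[OF c(1)] using c(2) by (rule if_not_P)
  moreover have "(\<Sum>a\<in>UNIV. \<chi> a) = int n - 2 * int (card T)"
    using count[of UNIV] by (simp only: T_def n_def UNIV_I simp_thms)
  ultimately have T: "int n = 2 * int (card T)" by linarith
  have "f \<chi> = s - 2 * int (card S1)" unfolding f_def s_def S1_def by (rule count)
  then have S1: "card T < 2 * card S1" using c3 T by linarith
  \<comment> \<open>If the value were 1, \<open>b\<close> to \<open>- a - b\<close> would be an
    involution of \<open>T\<close>. As \<open>S1\<close> fills more than half of \<open>T\<close>,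
    it meets its image, giving three elements of \<open>S\<close> with sum 0.\<close>
  have "\<chi> a = -1" if a: "a \<in> S" for a
  proof (rule ccontr)
    assume "\<chi> a \<noteq> -1"
    then have a1: "\<chi> a = 1" using sgn[OF c(1)] by blast
    have neg: "\<chi> (- a - b) = \<chi> b" for b
    proof -
      have "\<chi> (a + (- a - b) + b) = 1" using c(1) add_subgroupD(1)[OF H] by (simp add: X_def)
      then have "\<chi> (- a - b) * \<chi> b = 1" by (simp only: mult[OF c(1)] a1 mult_1)
      then show ?thesis by (auto simp: zmult_eq_1_iff)
    qed
    let ?g = "\<lambda>b. - a - b"
    have "card (?g ` S1) = card S1" by (rule card_image) (auto simp: inj_on_def)
    moreover have "?g ` S1 \<union> S1 \<subseteq> T" by (auto simp: S1_def T_def neg)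
    then have "card (?g ` S1 \<union> S1) \<le> card T" by (simp add: card_mono)
    ultimately have "?g ` S1 \<inter> S1 \<noteq> {}" using S1 card_Un_disjoint[of "?g ` S1" S1] by auto
    then obtain b where "b \<in> S" "- a - b \<in> S" by (auto simp: S1_def)
    then show False using free[OF a \<open>b \<in> S\<close> \<open>- a - b \<in> S\<close>] add_subgroupD(1)[OF H] by simp
  qed
  then show ?thesis using mult[OF c(1)] by (intro exI[of _ \<chi>]) simp
qed

text \<open>Apply the preceding lemma to \<open>c + D\<close>: modulo \<open>H\<close> doubles
  vanish, so three of its elements with sum in \<open>H\<close> would put \<open>c\<close> into
  \<open>D + D + D\<close>. The resulting character is -1 at \<open>c\<close> (as 0 is in
  \<open>D\<close>), hence 1 on \<open>D\<close>, and its kernel is a proper subgroup containing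
  \<open>D\<close>.\<close>

lemma not_generating_mod_2:
  fixes H D :: "'a::{ab_group_add, finite} set"
  assumes H: "add_subgroup H" and sq: "\<And>g. g + g \<in> H" and per: "H \<subseteq> period D" and "0 \<in> D"
    and c: "c \<notin> D + D + D" and big: "card (UNIV :: 'a set) < 3 * card D"
  shows "gen_subgroup D \<noteq> UNIV"
proof -
  have "\<exists>\<chi>::'a \<Rightarrow> int. (\<forall>a b. \<chi> (a + b) = \<chi> a * \<chi> b) \<and> (\<forall>a\<in>(+) c ` D. \<chi> a = -1)"
  proof (rule large_sum_free_mod_2[OF H sq])
    show "H \<subseteq> period ((+) c ` D)" using per by (simp add: period_translate)
    show "card (UNIV :: 'a set) < 3 * card ((+) c ` D)" using big by simp
    fix x y z assume "x \<in> (+) c ` D" "y \<in> (+) c ` D" "z \<in> (+) c ` D"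
    then obtain p q r where d: "p \<in> D" "q \<in> D" "r \<in> D" "x = c + p" "y = c + q" "z = c + r" by auto
    show "x + y + z \<notin> H"
    proof
      assume "x + y + z \<in> H"
      then have "(c + c) + (c + c) - (x + y + z) \<in> H" using add_subgroupD(2,4)[OF H] sq by metis
      then have "c - (p + q + r) \<in> H" unfolding d by (simp add: algebra_simps)
      then have "r + (c - (p + q + r)) \<in> D" using per d by (simp only: subgroup_le_period_iff)
      moreover have "c = p + q + (r + (c - (p + q + r)))" by simp
      ultimately show False using c d by (metis set_plus_intro)
    qed
  qed
  then obtain \<chi> :: "'a \<Rightarrow> int" where x: "\<And>a b. \<chi> (a + b) = \<chi> a * \<chi> b" and "\<forall>a\<in>(+) c ` D. \<chi> a = -1"
    by blast
  then have x2: "\<chi> (c + a) = -1" if "a \<in> D" for a using that by blast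
  have c1: "\<chi> c = -1" using x2[OF \<open>0 \<in> D\<close>] by simp
  have D1: "\<chi> a = 1" if "a \<in> D" for a using x2[OF that] x(1)[of c a] c1 by simp
  have "add_subgroup {a. \<chi> a = 1}"
    by (rule add_subgroup_finiteI) (use D1[OF \<open>0 \<in> D\<close>] in \<open>auto simp: x(1)\<close>)
  moreover have "D \<subseteq> {a. \<chi> a = 1}" "c \<notin> {a. \<chi> a = 1}" using D1 c1 by auto
  ultimately show ?thesis using gen_subgroup_least by blast
qed

text \<open>Saturating \<open>B\<close> by the period of \<open>B + B\<close> changes neither the
  twofold nor the threefold sumset. Hence the Kneser bound and the disjointness from
  \<open>c - B\<close> apply to the larger set \<open>B + H\<close>.\<close>

lemma sumset_hull:
  fixes B :: "'a::{ab_group_add, finite} set"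
  defines "H \<equiv> period (B + B)"
  assumes "B \<noteq> {}"
  shows "B + H + (B + H) + (B + H) = B + B + B" and "B \<subseteq> B + H" and "H \<subseteq> period (B + H)"
    and "B + B + B \<noteq> UNIV \<Longrightarrow> 3 * card (B + H) \<le> card (UNIV :: 'a set) + card H"
proof -
  have H: "add_subgroup H" by (simp add: H_def add_subgroup_period)
  have BBH: "B + B + H = B + B" by (simp add: H_def)
  have HH: "H + H = H" by (rule set_plus_subgroup_idem[OF H])
  have D2: "B + H + (B + H) = B + B"
  proof -
    have "B + H + (B + H) = B + B + (H + H)" by (simp only: ac_simps)
    then show ?thesis by (simp only: HH BBH)
  qed
  show D3: "B + H + (B + H) + (B + H) = B + B + B"
  proof -
    have "B + B + (B + H) = (B + B + H) + B" by (simp only: ac_simps)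
    then show ?thesis by (simp only: D2 BBH)
  qed
  show "B \<subseteq> B + H" using set_plus_intro[OF _ add_subgroupD(1)[OF H]] by fastforce
  show "H \<subseteq> period (B + H)"
    using set_plus_intro[of _ "B + H" _ H]
    by (auto simp: subgroup_le_period_iff) (metis HH add.assoc set_plus_intro)
  show "3 * card (B + H) \<le> card (UNIV :: 'a set) + card H" if ne: "B + B + B \<noteq> UNIV"
  proof -
    obtain c where c: "c \<notin> B + B + B" using ne by auto
    have "B + H \<noteq> {}" using \<open>B \<subseteq> B + H\<close> assms by auto
    then have k: "2 * card (B + H) \<le> card (B + B) + card H"
      using kneser[of "B + H" "B + H"] unfolding D2 by (simp add: H_def)
    let ?C = "(\<lambda>x. c - x) ` (B + H)"
    have "card ?C = card (B + H)" by (rule card_image) (auto simp: inj_on_def)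
    moreover have "(B + B) \<inter> ?C = {}"
    proof (rule ccontr)
      assume "(B + B) \<inter> ?C \<noteq> {}"
      then obtain x where "x \<in> B + H" "c - x \<in> B + B" by auto
      then have "(c - x) + x \<in> B + H + (B + H) + (B + H)" unfolding D2 by (rule set_plus_intro[rotated])
      then show False using c D3 by simp
    qed
    ultimately have "card (B + B) + card (B + H) = card ((B + B) \<union> ?C)" by (simp add: card_Un_disjoint)
    also have "\<dots> \<le> card (UNIV :: 'a set)" by (simp add: card_mono)
    finally show ?thesis using k by simp
  qed
qed

text \<open>Counted in cosets, the bound reads \<open>3 * b \<le> m + 1\<close>. Only equality
  exceeds one third; it forces \<open>m mod 3 = 2\<close>, and exponent 2 is then impossible because
  \<open>D\<close> generates.\<close>

lemma card_le_of_three_sumset_ne_UNIV: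
  fixes B :: "'a::{ab_group_add, finite} set"
  assumes "0 \<in> B" "gen_subgroup B = UNIV" "B + B + B \<noteq> UNIV"
  shows "(\<exists>H. add_subgroup H \<and> card (cosets H) mod 3 = 2 \<and> (\<exists>g::'a. g + g \<notin> H)
            \<and> 3 * card B \<le> card (UNIV :: 'a set) + card H)
       \<or> 3 * card B \<le> card (UNIV :: 'a set) \<and> (\<not> 3 dvd card (UNIV :: 'a set) \<longrightarrow> 3 * card B < card (UNIV :: 'a set))"
proof -
  define H where "H = period (B + B)"
  define D where "D = B + H"
  define m where "m = card (cosets H)"
  define b where "b = card ((\<lambda>s. (+) s ` H) ` D)"
  have ne: "B \<noteq> {}" using assms by auto
  note hull = sumset_hull[OF ne, folded H_def D_def]
  have H: "add_subgroup H" by (simp add: H_def add_subgroup_period)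
  have pos: "0 < card H" using card_subgroup_pos[OF H] .
  have n: "card (UNIV :: 'a set) = card H * m" by (simp add: m_def card_cosets[OF H])
  have D: "card D = card H * b" unfolding b_def by (rule card_periodic[OF H hull(3)])
  have BD: "card B \<le> card D" using hull(2) by (simp add: card_mono)
  have "card H * (3 * b) \<le> card H * (m + 1)" using hull(4) assms(3) n D by (simp add: algebra_simps)
  then have bm: "3 * b \<le> m + 1" using pos by (simp only: mult_le_cancel1)
  show ?thesis
  proof (cases "3 * b \<le> m")
    case True
    then have "3 * card D \<le> card (UNIV :: 'a set)" using n D by simp
    moreover have "3 * card D < card (UNIV :: 'a set)" if "\<not> 3 dvd card (UNIV :: 'a set)"
    proof -
      have "3 * card D \<noteq> card (UNIV :: 'a set)" using that by (metis dvd_triv_left)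
      then show ?thesis using calculation by simp
    qed
    ultimately show ?thesis using BD by auto
  next
    case False
    then have m2: "m mod 3 = 2" and eq: "3 * b = m + 1" using bm by presburger+
    have 3: "3 * card D = card (UNIV :: 'a set) + card H"
      using n D eq by (metis add_mult_distrib2 mult.left_commute mult.right_neutral)
    have "\<exists>g::'a. g + g \<notin> H"
    proof (rule ccontr)
      assume "\<not> ?thesis"
      moreover obtain c where "c \<notin> D + D + D" using assms(3) hull(1) by auto
      moreover have "gen_subgroup D = UNIV" using gen_subgroup_mono[OF hull(2)] assms(2) by auto
      ultimately show False
        using not_generating_mod_2[OF H _ hull(3), of c] hull(2) assms(1) 3 pos by auto
    qed
    then show ?thesis using H m2 3 BD unfolding m_def by fastforce
  qed
qed

section \<open>Cyclic extensions of subgroups\<close>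

text \<open>The subgroup generated by \<open>K\<close> and \<open>g\<close>, for a subgroup
  \<open>K\<close> of a finite group; natural multiples of \<open>g\<close> suffice because negative
  ones coincide with them.\<close>

definition adjoin :: "'a::ab_group_add set \<Rightarrow> 'a \<Rightarrow> 'a set" where
  "adjoin K g = {x. \<exists>i. x - nsmul i g \<in> K}"

lemma add_subgroup_adjoin:
  fixes K :: "'a::{ab_group_add, finite} set"
  assumes "add_subgroup K"
  shows "add_subgroup (adjoin K g)"
proof (rule add_subgroup_finiteI)
  show "0 \<in> adjoin K g"
    unfolding adjoin_def using add_subgroupD(1)[OF assms] by (intro CollectI exI[of _ 0]) simp
  fix x y assume "x \<in> adjoin K g" "y \<in> adjoin K g"
  then obtain i j where "x - nsmul i g \<in> K" "y - nsmul j g \<in> K" by (auto simp: adjoin_def)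
  then have "(x - nsmul i g) + (y - nsmul j g) \<in> K" by (rule add_subgroupD(2)[OF assms])
  then show "x + y \<in> adjoin K g"
    unfolding adjoin_def by (intro CollectI exI[of _ "i + j"]) (simp add: nsmul_add algebra_simps)
qed

lemma subset_adjoin: "K \<subseteq> adjoin K g"
proof
  fix x assume "x \<in> K"
  then show "x \<in> adjoin K g" unfolding adjoin_def by (intro CollectI exI[of _ 0]) simp
qed

lemma nsmul_mem_adjoin: "add_subgroup K \<Longrightarrow> nsmul i g \<in> adjoin K g"
  unfolding adjoin_def using add_subgroupD(1) by (intro CollectI exI[of _ i]) simp

lemma mem_adjoin_self: "add_subgroup K \<Longrightarrow> g \<in> adjoin K g"
  using nsmul_mem_adjoin[of K 1 g] by simp

lemma adjoin_least:
  assumes "add_subgroup M" "K \<subseteq> M" "g \<in> M"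
  shows "adjoin K g \<subseteq> M"
proof
  fix x assume "x \<in> adjoin K g"
  then obtain i where "x - nsmul i g \<in> M" using assms(2) by (auto simp: adjoin_def)
  then have "(x - nsmul i g) + nsmul i g \<in> M"
    using nsmul_mem[OF assms(1,3)] add_subgroupD(2)[OF assms(1)] by blast
  then show "x \<in> M" by simp
qed

lemma card_dvd_card_subgroup:
  fixes H K :: "'a::{ab_group_add, finite} set"
  assumes "add_subgroup H" "add_subgroup K" "H \<subseteq> K"
  obtains q where "card K = q * card H"
proof -
  have "H \<subseteq> period K"
    unfolding subgroup_le_period_iff using assms(3) add_subgroupD(2)[OF assms(2)] by auto
  then show ?thesis using card_periodic[OF assms(1), of K] that by (metis mult.commute)
qed

text \<open>\<open>m\<close> is the order of \<open>g\<close> modulo \<open>K\<close>; the multiples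
  of \<open>g\<close> below \<open>m\<close> serve as residues for the cyclic quotient.\<close>

lemma cyclic_extension:
  fixes K :: "'a::{ab_group_add, finite} set"
  assumes K: "add_subgroup K"
  obtains m where "0 < m" "\<And>i. nsmul i g \<in> K \<longleftrightarrow> m dvd i"
    "\<And>i j. i < m \<Longrightarrow> j < m \<Longrightarrow> nsmul i g - nsmul j g \<in> K \<Longrightarrow> i = j"
    "adjoin K g = (\<Union>i<m. (+) (nsmul i g) ` K)"
proof -
  define m where "m = (LEAST m. 0 < m \<and> nsmul m g \<in> K)"
  have "0 < card (UNIV :: 'a set) \<and> nsmul (card (UNIV :: 'a set)) g \<in> K"
    using add_subgroupD(1)[OF K] by (simp add: card_gt_0_iff)
  then have m: "0 < m \<and> nsmul m g \<in> K" unfolding m_def by (rule LeastI)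
  have small: "i = 0" if "i < m" "nsmul i g \<in> K" for i
    using not_less_Least[of i "\<lambda>m. 0 < m \<and> nsmul m g \<in> K"] that by (auto simp: m_def)
  have red: "nsmul i g - nsmul (i mod m) g \<in> K" for i
  proof -
    have "nsmul (i div m * m + i mod m) g = nsmul (i div m) (nsmul m g) + nsmul (i mod m) g"
      by (simp only: nsmul_add nsmul_mult)
    then have "nsmul i g - nsmul (i mod m) g = nsmul (i div m) (nsmul m g)" by simp
    then show ?thesis using nsmul_mem[OF K] m by simp
  qed
  have dvd: "nsmul i g \<in> K \<longleftrightarrow> m dvd i" for i
  proof
    assume "nsmul i g \<in> K"
    then have "nsmul i g - (nsmul i g - nsmul (i mod m) g) \<in> K" using red add_subgroupD(4)[OF K] by blast
    then have "nsmul (i mod m) g \<in> K" by simp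
    then show "m dvd i" using small m by (metis mod_less_divisor dvd_eq_mod_eq_0)
  next
    assume "m dvd i"
    then have "i mod m = 0" by (simp add: dvd_eq_mod_eq_0)
    then show "nsmul i g \<in> K" using red[of i] by simp
  qed
  have inj: "i = j" if "i < m" "j < m" "nsmul i g - nsmul j g \<in> K" for i j
    using that
  proof (induction i j rule: linorder_wlog)
    case (le i j)
    have "nsmul j g = nsmul (j - i) g + nsmul i g" using le(1) by (simp flip: nsmul_add)
    then have "nsmul (j - i) g = - (nsmul i g - nsmul j g)" by (simp add: algebra_simps)
    then have "nsmul (j - i) g \<in> K" using le add_subgroupD(3)[OF K] by metis
    moreover have "j - i < m" using le by simp
    ultimately have "j - i = 0" using small by blast
    then show ?case using le by simp
  next
    case (sym i j)
    have "nsmul j g - nsmul i g \<in> K" using add_subgroupD(3)[OF K sym(4)] by simp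
    then show ?case using sym(1-3) by simp
  qed
  have "adjoin K g = (\<Union>i<m. (+) (nsmul i g) ` K)"
  proof (intro set_eqI iffI)
    fix x assume "x \<in> adjoin K g"
    then obtain i where i: "x - nsmul i g \<in> K" by (auto simp: adjoin_def)
    have "(x - nsmul i g) + (nsmul i g - nsmul (i mod m) g) \<in> K"
      by (rule add_subgroupD(2)[OF K i red])
    then have "x \<in> (+) (nsmul (i mod m) g) ` K" by (simp add: mem_coset_iff)
    moreover have "i mod m < m" using m by simp
    ultimately show "x \<in> (\<Union>i<m. (+) (nsmul i g) ` K)" by blast
  next
    fix x assume "x \<in> (\<Union>i<m. (+) (nsmul i g) ` K)"
    then obtain i where "x \<in> (+) (nsmul i g) ` K" by auto
    then show "x \<in> adjoin K g" unfolding adjoin_def mem_coset_iff by auto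
  qed
  then show ?thesis using that m dvd inj by metis
qed

text \<open>If \<open>L\<close> is maximal among the proper subgroups of \<open>K\<close> above
  \<open>H\<close>, any element of \<open>K\<close> outside \<open>L\<close> generates
  \<open>K\<close> over \<open>L\<close>. Repeated descent gives a chain with cyclic
  factors.\<close>

lemma ex_cyclic_step:
  fixes H K :: "'a::{ab_group_add, finite} set"
  assumes "add_subgroup H" "add_subgroup K" "H \<subset> K"
  obtains L g where "add_subgroup L" "H \<subseteq> L" "L \<subset> K" "g \<in> K" "g \<notin> L" "adjoin L g = K"
proof -
  obtain L where L: "add_subgroup L" "H \<subseteq> L" "L \<subset> K" "\<And>M. add_subgroup M \<Longrightarrow> L \<subset> M \<Longrightarrow> \<not> M \<subset> K"
    by (rule ex_maximal_subgroup[of H "\<lambda>L. L \<subset> K", OF assms(1,3)]) auto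
  then obtain g where g: "g \<in> K" "g \<notin> L" by auto
  have "adjoin L g \<subseteq> K" using adjoin_least[OF assms(2)] L(3) g(1) by auto
  moreover have "L \<subset> adjoin L g" using subset_adjoin mem_adjoin_self[OF L(1)] g(2) by blast
  ultimately have "adjoin L g = K" using L(4)[OF add_subgroup_adjoin[OF L(1)]] by auto
  then show ?thesis using that L g by blast
qed

section \<open>Sets of density close to \<open>1/3\<close>\<close>

text \<open>In the cyclic quotient: the residues below \<open>k\<close> in full, and a part
  \<open>C\<close> of residue \<open>k\<close>. \<open>C = K\<close> suits order
  \<open>3k + 2\<close>; a thinner \<open>C\<close> suits order \<open>3k + 1\<close>.\<close>

definition block :: "'a::ab_group_add set \<Rightarrow> 'a \<Rightarrow> nat \<Rightarrow> 'a set \<Rightarrow> 'a set" where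
  "block K g k C = (\<Union>i<k. (+) (nsmul i g) ` K) \<union> (+) (nsmul k g) ` C"

lemma card_block:
  fixes K :: "'a::{ab_group_add, finite} set"
  assumes K: "add_subgroup K" and inj: "\<And>i j. i < m \<Longrightarrow> j < m \<Longrightarrow> nsmul i g - nsmul j g \<in> K \<Longrightarrow> i = j"
    and "k < m" "C \<subseteq> K"
  shows "card (block K g k C) = k * card K + card C"
proof -
  have disj: "i = j" if "i < m" "j < m" "x - nsmul i g \<in> K" "x - nsmul j g \<in> K" for x i j
  proof -
    have "(x - nsmul j g) - (x - nsmul i g) \<in> K" using that add_subgroupD(4)[OF K] by blast
    then show ?thesis using inj that by simp
  qed
  have "card (\<Union>i<k. (+) (nsmul i g) ` K) = (\<Sum>i<k. card ((+) (nsmul i g) ` K))"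
  proof (rule card_UN_disjoint)
    show "\<forall>i\<in>{..<k}. \<forall>j\<in>{..<k}. i \<noteq> j \<longrightarrow> (+) (nsmul i g) ` K \<inter> (+) (nsmul j g) ` K = {}"
      unfolding disjoint_iff mem_coset_iff using disj \<open>k < m\<close> by (meson lessThan_iff less_trans)
  qed auto
  moreover have "(\<Union>i<k. (+) (nsmul i g) ` K) \<inter> (+) (nsmul k g) ` C = {}"
  proof (rule ccontr)
    assume "\<not> ?thesis"
    then obtain x i where "i < k" "x \<in> (+) (nsmul i g) ` K" "x \<in> (+) (nsmul k g) ` C" by auto
    then have "x - nsmul i g \<in> K" "x - nsmul k g \<in> K" using assms(4) unfolding mem_coset_iff by auto
    then show False using disj[of i k x] \<open>i < k\<close> \<open>k < m\<close> by simp
  qed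
  ultimately show ?thesis unfolding block_def by (subst card_Un_disjoint) auto
qed

text \<open>Three residues at most \<open>k\<close> add up to \<open>3 * k\<close> only if all equal
  \<open>k\<close>, so the top residue sees only \<open>C + C + C\<close>.\<close>

lemma mem_block_three_sumset:
  assumes K: "add_subgroup K" and C: "C \<subseteq> K" and x: "x \<in> block K g k C + block K g k C + block K g k C"
  shows "\<exists>i\<le>3 * k. x - nsmul i g \<in> K \<and> (i = 3 * k \<longrightarrow> x - nsmul i g \<in> C + C + C)"
proof -
  have m: "\<exists>i\<le>k. \<exists>h\<in>K. a = nsmul i g + h \<and> (i = k \<longrightarrow> h \<in> C)" if a: "a \<in> block K g k C" for a
  proof -
    consider i h where "i < k" "h \<in> K" "a = nsmul i g + h" | h where "h \<in> C" "a = nsmul k g + h"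
      using a unfolding block_def by auto
    then show ?thesis
    proof cases
      case (1 i h)
      then show ?thesis by (intro exI[of _ i] conjI bexI[of _ h]) auto
    next
      case (2 h)
      then show ?thesis using C by (intro exI[of _ k] conjI bexI[of _ h]) auto
    qed
  qed
  obtain a b c where abc: "a \<in> block K g k C" "b \<in> block K g k C" "c \<in> block K g k C" "x = a + b + c"
    using x by (auto elim!: set_plus_elim)
  obtain i1 h1 where 1: "i1 \<le> k" "h1 \<in> K" "a = nsmul i1 g + h1" "i1 = k \<longrightarrow> h1 \<in> C" using m[OF abc(1)] by auto
  obtain i2 h2 where 2: "i2 \<le> k" "h2 \<in> K" "b = nsmul i2 g + h2" "i2 = k \<longrightarrow> h2 \<in> C" using m[OF abc(2)] by auto
  obtain i3 h3 where 3: "i3 \<le> k" "h3 \<in> K" "c = nsmul i3 g + h3" "i3 = k \<longrightarrow> h3 \<in> C" using m[OF abc(3)] by auto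
  have x: "x - nsmul (i1 + i2 + i3) g = h1 + h2 + h3"
    by (simp add: abc 1 2 3 nsmul_add algebra_simps)
  have "h1 + h2 + h3 \<in> K" using 1 2 3 add_subgroupD(2)[OF K] by simp
  moreover have "h1 + h2 + h3 \<in> C + C + C" if "i1 + i2 + i3 = 3 * k"
    using 1 2 3 that by (intro set_plus_intro) auto
  ultimately show ?thesis using 1 2 3 x by (intro exI[of _ "i1 + i2 + i3"]) auto
qed

text \<open>Meant for \<open>m = 3k + 1\<close>: the residues up to \<open>3 * k\<close> are
  distinct, so no wrap-around helps to reach the top coset.\<close>

lemma block_avoids_top:
  assumes K: "add_subgroup K" and inj: "\<And>i j. i < m \<Longrightarrow> j < m \<Longrightarrow> nsmul i g - nsmul j g \<in> K \<Longrightarrow> i = j"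
    and C: "C \<subseteq> K" and "3 * k < m" "c \<in> K" "c \<notin> C + C + C"
  shows "nsmul (3 * k) g + c \<notin> block K g k C + block K g k C + block K g k C"
proof
  assume "nsmul (3 * k) g + c \<in> block K g k C + block K g k C + block K g k C"
  then obtain i where i: "i \<le> 3 * k" "nsmul (3 * k) g + c - nsmul i g \<in> K"
    "i = 3 * k \<longrightarrow> nsmul (3 * k) g + c - nsmul i g \<in> C + C + C"
    using mem_block_three_sumset[OF K C] by blast
  then have "(nsmul (3 * k) g + c - nsmul i g) - c \<in> K" using \<open>c \<in> K\<close> add_subgroupD(4)[OF K] by blast
  then have "3 * k = i" using i(1) \<open>3 * k < m\<close> by (intro inj) auto
  then show False using i(3) assms(6) by simp
qed

text \<open>Meant for \<open>m = 3k + 2\<close>, where a whole residue beyond \<open>3 * k\<close>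
  remains free for any \<open>C\<close>.\<close>

lemma block_avoids_next:
  assumes K: "add_subgroup K" and inj: "\<And>i j. i < m \<Longrightarrow> j < m \<Longrightarrow> nsmul i g - nsmul j g \<in> K \<Longrightarrow> i = j"
    and C: "C \<subseteq> K" and "3 * k + 1 < m"
  shows "nsmul (3 * k + 1) g \<notin> block K g k C + block K g k C + block K g k C"
proof
  assume "nsmul (3 * k + 1) g \<in> block K g k C + block K g k C + block K g k C"
  then obtain i where i: "i \<le> 3 * k" "nsmul (3 * k + 1) g - nsmul i g \<in> K"
    using mem_block_three_sumset[OF K C] by blast
  then have "3 * k + 1 = i" using \<open>3 * k + 1 < m\<close> by (intro inj) auto
  then show False using i(1) by simp
qed

lemma block_subset_adjoin:
  assumes K: "add_subgroup K" and C: "C \<subseteq> K"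
  shows "block K g k C \<subseteq> adjoin K g"
  using C unfolding block_def adjoin_def by (auto simp: mem_coset_iff subset_iff)

lemma card_adjoin:
  fixes K :: "'a::{ab_group_add, finite} set"
  assumes K: "add_subgroup K" and inj: "\<And>i j. i < m \<Longrightarrow> j < m \<Longrightarrow> nsmul i g - nsmul j g \<in> K \<Longrightarrow> i = j"
    and "adjoin K g = (\<Union>i<m. (+) (nsmul i g) ` K)" "0 < m"
  shows "card (adjoin K g) = m * card K"
proof -
  \<comment> \<open>The whole extension is itself a block, with its top coset full.\<close>
  have "{..<m} = insert (m - 1) {..<m - 1}" using \<open>0 < m\<close> by auto
  then have "adjoin K g = block K g (m - 1) K" unfolding assms(3) block_def by auto
  moreover have "card (block K g (m - 1) K) = (m - 1) * card K + card K"
    by (rule card_block[OF K inj]) (use \<open>0 < m\<close> in auto)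
  ultimately show ?thesis using \<open>0 < m\<close> by (cases m) auto
qed

lemma mult_mod_3: "(a * b) mod 3 = ((a mod 3) * (b mod 3)) mod (3::nat)"
  by (simp add: mod_mult_eq)

lemma mod_3_cases: "a mod 3 = 0 \<or> a mod 3 = 1 \<or> a mod 3 = (2::nat)"
  by presburger

text \<open>Induction down a chain of cyclic extensions. A factor of order \<open>3k + 2\<close>
  ends the descent with a full top coset. A factor of order \<open>3k + 1\<close> passes the deficit
  on unchanged, \<open>card K - 3 * card A = card L - 3 * card C\<close>. At \<open>K = H\<close>
  the empty set has deficit \<open>card H\<close>.\<close>

lemma ex_large_avoiding_subset:
  fixes H K :: "'a::{ab_group_add, finite} set"
  assumes "add_subgroup H" "add_subgroup K" "H \<subseteq> K" "card K = q * card H" "q mod 3 \<noteq> 0"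
  shows "\<exists>A\<subseteq>K. (\<exists>c\<in>K. c \<notin> A + A + A) \<and> (q mod 3 = 2 \<longrightarrow> card K + card H \<le> 3 * card A)
           \<and> (q mod 3 = 1 \<longrightarrow> card K \<le> 3 * card A + card H)"
  using assms
proof (induction "card K" arbitrary: K q rule: less_induct)
  case less
  note H = less.prems(1) and K = less.prems(2)
  have Hpos: "0 < card H" using card_subgroup_pos[OF H] .
  show ?case
  proof (cases "H = K")
    case True
    then have "1 * card H = q * card H" using less.prems(4) by simp
    then have "q = 1" using Hpos by (metis mult_cancel2 less_irrefl)
    moreover have "0 \<in> K \<and> (0::'a) \<notin> {} + {} + {}" using add_subgroupD(1)[OF K] by (auto simp: set_plus_def)
    ultimately show ?thesis using True by (intro exI[of _ "{}"]) auto
  next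
    case False
    then obtain L g where L: "add_subgroup L" "H \<subseteq> L" "L \<subset> K" "g \<in> K" "g \<notin> L" "adjoin L g = K"
      using ex_cyclic_step[OF H K] less.prems(3) by blast
    obtain m where m: "0 < m" "\<And>i. nsmul i g \<in> L \<longleftrightarrow> m dvd i"
      "\<And>i j. i < m \<Longrightarrow> j < m \<Longrightarrow> nsmul i g - nsmul j g \<in> L \<Longrightarrow> i = j"
      "adjoin L g = (\<Union>i<m. (+) (nsmul i g) ` L)"
      using cyclic_extension[OF L(1), of g] by blast
    have cK: "card K = m * card L" using card_adjoin[OF L(1) m(3,4,1)] L(6) by simp
    obtain r where r: "card L = r * card H" using card_dvd_card_subgroup[OF H L(1,2)] by blast
    have HL: "card H \<le> card L" using L(2) by (simp add: card_mono)
    have "q * card H = m * r * card H" using less.prems(4) cK r by (metis mult.assoc)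
    then have q: "q = m * r" using Hpos by (metis mult_cancel2 less_irrefl)
    have mr: "q mod 3 = ((m mod 3) * (r mod 3)) mod 3" unfolding q by (rule mult_mod_3)
    define k where "k = m div 3"
    show ?thesis
    proof (cases "m mod 3 = 2")
      case True
      then have mk: "m = 3 * k + 2" by (simp add: k_def) presburger
      let ?A = "block L g k L"
      have "card ?A = k * card L + card L" by (rule card_block[OF L(1) m(3)]) (use mk in auto)
      then have "3 * card ?A = card K + card L" by (simp add: cK mk algebra_simps)
      moreover have "nsmul (3 * k + 1) g \<notin> ?A + ?A + ?A"
        by (rule block_avoids_next[OF L(1) m(3)]) (use mk in auto)
      moreover have "nsmul (3 * k + 1) g \<in> K" by (rule nsmul_mem[OF K L(4)])
      moreover have "?A \<subseteq> K" using block_subset_adjoin[OF L(1)] L(6) by blast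
      ultimately show ?thesis using HL by (intro exI[of _ ?A]) auto
    next
      case False
      moreover have "m mod 3 \<noteq> 0" using mr less.prems(5) by (metis mult_0 mod_0)
      ultimately have m1: "m mod 3 = 1" using mod_3_cases[of m] by auto
      then have mk: "m = 3 * k + 1" by (simp add: k_def) presburger
      have rq: "r mod 3 = q mod 3" using mr m1 by simp
      have "card L < card K" using L(3) by (simp add: psubset_card_mono)
      then obtain C c where C: "C \<subseteq> L" "c \<in> L" "c \<notin> C + C + C"
        "r mod 3 = 2 \<longrightarrow> card L + card H \<le> 3 * card C" "r mod 3 = 1 \<longrightarrow> card L \<le> 3 * card C + card H"
        using less.hyps[OF _ H L(1,2) r] rq less.prems(5) by auto
      let ?A = "block L g k C"
      have cA: "card ?A = k * card L + card C" by (rule card_block[OF L(1) m(3)]) (use mk C in auto)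
      have cK': "card K = 3 * (k * card L) + card L" by (simp add: cK mk algebra_simps)
      have "nsmul (3 * k) g + c \<notin> ?A + ?A + ?A"
        by (rule block_avoids_top[OF L(1) m(3)]) (use mk C in auto)
      moreover have "nsmul (3 * k) g + c \<in> K"
        using nsmul_mem[OF K L(4)] add_subgroupD(2)[OF K] C(2) L(3) by auto
      moreover have "?A \<subseteq> K" using block_subset_adjoin[OF L(1) C(1)] L(6) by blast
      moreover have "q mod 3 = 2 \<longrightarrow> card K + card H \<le> 3 * card ?A"
        using C(4) rq cA cK' by (simp add: algebra_simps)
      moreover have "q mod 3 = 1 \<longrightarrow> card K \<le> 3 * card ?A + card H"
        using C(5) rq cA cK' by (simp add: algebra_simps)
      ultimately show ?thesis by (intro exI[of _ ?A]) auto
    qed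
  qed
qed

text \<open>Maximality of \<open>K\<close> makes the quotient cyclic (of odd prime order or of order 4).\<close>

lemma ex_cyclic_quotient_exponent_ne_2:
  fixes H :: "'a::{ab_group_add, finite} set"
  assumes H: "add_subgroup H" and "\<exists>g::'a. g + g \<notin> H"
  obtains K g where "add_subgroup K" "H \<subseteq> K" "g + g \<notin> K" "adjoin K g = UNIV"
proof -
  obtain K where K: "add_subgroup K" "H \<subseteq> K" "\<exists>g. g + g \<notin> K"
    "\<And>L. add_subgroup L \<Longrightarrow> K \<subset> L \<Longrightarrow> \<not> (\<exists>g. g + g \<notin> L)"
    by (rule ex_maximal_subgroup[of H "\<lambda>K. \<exists>g. g + g \<notin> K", OF assms]) auto
  obtain g where g: "g + g \<notin> K" using K(3) by blast
  have above: "y + y \<in> adjoin K x" if "x \<notin> K" for x y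
  proof -
    have "K \<subset> adjoin K x" using subset_adjoin mem_adjoin_self[OF K(1)] that by blast
    then show ?thesis using K(4)[OF add_subgroup_adjoin[OF K(1)]] by blast
  qed
  have "y \<in> adjoin K g" for y
  proof (rule ccontr)
    assume y: "y \<notin> adjoin K g"
    \<comment> \<open>Adjoining \<open>g + g\<close> instead of \<open>g\<close> makes
      \<open>y + y\<close> an even multiple of \<open>g\<close> modulo \<open>K\<close>; halving it
      corrects \<open>y\<close> to an element \<open>w\<close> with \<open>w + w\<close> in
      \<open>K\<close>.\<close>
    obtain j where j: "y + y - nsmul j (g + g) \<in> K" using above[OF g, of y] by (auto simp: adjoin_def)
    define w where "w = y - nsmul j g"
    have w: "w + w \<in> K" using j by (simp add: w_def nsmul_distrib algebra_simps)
    have wN: "w \<notin> adjoin K g"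
    proof
      assume "w \<in> adjoin K g"
      then have "w + nsmul j g \<in> adjoin K g"
        using nsmul_mem_adjoin[OF K(1)] add_subgroupD(2)[OF add_subgroup_adjoin[OF K(1)]] by blast
      then show False using y by (simp add: w_def)
    qed
    then have "w \<notin> K" using subset_adjoin by blast
    \<comment> \<open>As \<open>w + w\<close> lies in \<open>K\<close>, only the parity of
      \<open>i\<close> matters: even puts \<open>g + g\<close> into \<open>K\<close>, odd puts
      \<open>w\<close> into \<open>adjoin K g\<close>.\<close>
    then obtain i where i: "g + g - nsmul i w \<in> K" using above[of w g] by (auto simp: adjoin_def)
    define t where "t = nsmul (i div 2) (w + w)"
    have t: "t \<in> K" using nsmul_mem[OF K(1) w] by (simp add: t_def)
    have "nsmul (i div 2 * 2 + i mod 2) w = t + nsmul (i mod 2) w"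
      unfolding nsmul_add nsmul_mult nsmul_two t_def ..
    then have i2: "nsmul i w = t + nsmul (i mod 2) w" by simp
    have "(g + g - nsmul i w) + t \<in> K" using add_subgroupD(2)[OF K(1) i t] .
    then have gw: "g + g - nsmul (i mod 2) w \<in> K" by (simp add: i2 algebra_simps)
    show False
    proof (cases "i mod 2 = 0")
      case True
      then show ?thesis using gw g by simp
    next
      case False
      then have "i mod 2 = 1" by simp
      then have "g + g - w \<in> K" using gw by simp
      then have "(g + g) - (g + g - w) \<in> adjoin K g"
        using subset_adjoin[of K g] mem_adjoin_self[OF K(1), of g]
          add_subgroupD(2,4)[OF add_subgroup_adjoin[OF K(1), of g]] by (meson subsetD)
      then show ?thesis using wN by simp
    qed
  qed
  then have "adjoin K g = UNIV" by auto
  then show ?thesis using that K(1,2) g by blast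
qed

text \<open>The correction \<open>h\<close> is there because for \<open>k = 1\<close> residue 1 of a
  block holds only a translate of \<open>C\<close>, which may lack 0.\<close>

lemma gen_subgroup_eq_UNIV_of_adjoin:
  assumes "add_subgroup K" "adjoin K g = UNIV" "K \<subseteq> A" "h \<in> K" "g + h \<in> A"
  shows "gen_subgroup A = UNIV"
  unfolding gen_subgroup_eq_UNIV_iff
proof (intro allI impI)
  fix M assume M: "add_subgroup M" "A \<subseteq> M"
  have "g + h \<in> M" "h \<in> M" using assms M by auto
  then have "(g + h) - h \<in> M" using add_subgroupD(4)[OF M(1)] by blast
  then have "adjoin K g \<subseteq> M" using adjoin_least[OF M(1)] assms(3) M(2) by simp
  then show "M = UNIV" using assms(2) by auto
qed

text \<open>The top step of the recursion, taken over a cyclic quotient of order at least 3. Then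
  \<open>k\<close> is positive, so the block contains \<open>K\<close>; it generates as soon as it
  meets residue 1.\<close>

lemma ex_large_generating_set:
  fixes H :: "'a::{ab_group_add, finite} set"
  assumes H: "add_subgroup H" and sq: "\<exists>g::'a. g + g \<notin> H" and q: "card (UNIV :: 'a set) = q * card H"
    and q3: "q mod 3 \<noteq> 0" and q4: "q \<noteq> 4"
  shows "\<exists>A :: 'a set. 0 \<in> A \<and> gen_subgroup A = UNIV \<and> A + A + A \<noteq> UNIV
    \<and> (q mod 3 = 2 \<longrightarrow> card (UNIV :: 'a set) + card H \<le> 3 * card A)
    \<and> (q mod 3 = 1 \<longrightarrow> card (UNIV :: 'a set) \<le> 3 * card A + card H)"
proof -
  obtain K g where K: "add_subgroup K" "H \<subseteq> K" "g + g \<notin> K" "adjoin K g = UNIV"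
    using ex_cyclic_quotient_exponent_ne_2[OF H sq] by blast
  obtain m where m: "0 < m" "\<And>i. nsmul i g \<in> K \<longleftrightarrow> m dvd i"
    "\<And>i j. i < m \<Longrightarrow> j < m \<Longrightarrow> nsmul i g - nsmul j g \<in> K \<Longrightarrow> i = j"
    "adjoin K g = (\<Union>i<m. (+) (nsmul i g) ` K)"
    using cyclic_extension[OF K(1), of g] by blast
  have "\<not> m dvd 2" using m(2)[of 2] K(3) by (simp add: nsmul_two)
  then have m3: "3 \<le> m" using m(1) by (cases "m = 1 \<or> m = 2") auto
  have cU: "card (UNIV :: 'a set) = m * card K" using card_adjoin[OF K(1) m(3,4,1)] K(4) by simp
  obtain r where r: "card K = r * card H" using card_dvd_card_subgroup[OF H K(1,2)] by blast
  have Hpos: "0 < card H" using card_subgroup_pos[OF H] .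
  have HK: "card H \<le> card K" using K(2) by (simp add: card_mono)
  have "q * card H = m * r * card H" using q cU r by (metis mult.assoc)
  then have qmr: "q = m * r" using Hpos by (metis mult_cancel2 less_irrefl)
  have mr: "q mod 3 = ((m mod 3) * (r mod 3)) mod 3" unfolding qmr by (rule mult_mod_3)
  define k where "k = m div 3"
  have k: "1 \<le> k" using m3 by (simp add: k_def)
  have KA: "K \<subseteq> block K g k C" for C
  proof
    fix x assume "x \<in> K"
    then have "x \<in> (+) (nsmul 0 g) ` K" by simp
    moreover have "0 \<in> {..<k}" using k by simp
    ultimately show "x \<in> block K g k C" unfolding block_def by (intro UnI1 UN_I)
  qed
  have 0: "0 \<in> block K g k C" for C using KA add_subgroupD(1)[OF K(1)] by blast
  have gA: "\<exists>h\<in>K. g + h \<in> block K g k C" if C: "C \<noteq> {} \<or> 2 \<le> k" "C \<subseteq> K" for C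
  proof (cases "2 \<le> k")
    case True
    have "g + 0 \<in> (+) (nsmul 1 g) ` K"
      unfolding mem_coset_iff using add_subgroupD(1)[OF K(1)] by simp
    moreover have "1 \<in> {..<k}" using True by simp
    ultimately have "g + 0 \<in> block K g k C" unfolding block_def by (intro UnI1 UN_I)
    then show ?thesis using add_subgroupD(1)[OF K(1)] by (rule bexI)
  next
    case False
    then have "k = 1" using k by simp
    obtain h where "h \<in> C" using C False by auto
    then have "g + h \<in> block K g k C" unfolding block_def \<open>k = 1\<close> nsmul_one by (intro UnI2 imageI)
    then show ?thesis using \<open>h \<in> C\<close> C(2) by (intro bexI[of _ h]) auto
  qed
  show ?thesis
  proof (cases "m mod 3 = 2")
    case True
    then have mk: "m = 3 * k + 2" by (simp add: k_def) presburger
    let ?A = "block K g k K"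
    have "card ?A = k * card K + card K" by (rule card_block[OF K(1) m(3)]) (use mk in auto)
    then have "3 * card ?A = card (UNIV :: 'a set) + card K" by (simp add: cU mk algebra_simps)
    moreover have "nsmul (3 * k + 1) g \<notin> ?A + ?A + ?A"
      by (rule block_avoids_next[OF K(1) m(3)]) (use mk in auto)
    then have "?A + ?A + ?A \<noteq> UNIV" by auto
    moreover have "gen_subgroup ?A = UNIV"
      using gA[of K] add_subgroupD(1)[OF K(1)] gen_subgroup_eq_UNIV_of_adjoin[OF K(1,4) KA] by blast
    ultimately show ?thesis using HK 0[of K] by (intro exI[of _ ?A]) auto
  next
    case False
    moreover have "m mod 3 \<noteq> 0" using mr q3 by (metis mult_0 mod_0)
    ultimately have m1: "m mod 3 = 1" using mod_3_cases[of m] by auto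
    then have mk: "m = 3 * k + 1" by (simp add: k_def) presburger
    have rq: "r mod 3 = q mod 3" using mr m1 by simp
    obtain C c where C: "C \<subseteq> K" "c \<in> K" "c \<notin> C + C + C"
      "r mod 3 = 2 \<longrightarrow> card K + card H \<le> 3 * card C" "r mod 3 = 1 \<longrightarrow> card K \<le> 3 * card C + card H"
      using ex_large_avoiding_subset[OF H K(1,2) r] rq q3 by auto
    let ?A = "block K g k C"
    have cA: "card ?A = k * card K + card C" by (rule card_block[OF K(1) m(3)]) (use mk C in auto)
    have cU': "card (UNIV :: 'a set) = 3 * (k * card K) + card K" by (simp add: cU mk algebra_simps)
    have "nsmul (3 * k) g + c \<notin> ?A + ?A + ?A"
      by (rule block_avoids_top[OF K(1) m(3)]) (use mk C in auto)
    then have "?A + ?A + ?A \<noteq> UNIV" by auto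
    moreover have "q mod 3 = 2 \<longrightarrow> card (UNIV :: 'a set) + card H \<le> 3 * card ?A"
      using C(4) rq cA cU' by (simp add: algebra_simps)
    moreover have "q mod 3 = 1 \<longrightarrow> card (UNIV :: 'a set) \<le> 3 * card ?A + card H"
      using C(5) rq cA cU' by (simp add: algebra_simps)
    \<comment> \<open>Residue 1 is missed only if \<open>k = 1\<close> and \<open>C\<close> is
      empty; the size bounds then force \<open>r = 1\<close> and \<open>q = 4\<close>.\<close>
    moreover have "C \<noteq> {} \<or> 2 \<le> k"
    proof (rule ccontr)
      assume n: "\<not> ?thesis"
      then have "k = 1" "card C = 0" using k by auto
      then have "r mod 3 \<noteq> 2" "r mod 3 = 1 \<longrightarrow> card K \<le> card H" using C(4,5) Hpos by auto
      then have "r mod 3 = 1" "card K \<le> card H" using rq q3 mod_3_cases[of r] by auto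
      then have "r = 1" using r Hpos HK by (cases r) auto
      then show False using qmr mk \<open>k = 1\<close> q4 by simp
    qed
    then have "gen_subgroup ?A = UNIV"
      using gA[of C] C(1) gen_subgroup_eq_UNIV_of_adjoin[OF K(1,4) KA] by blast
    ultimately show ?thesis using 0[of C] by (intro exI[of _ ?A]) auto
  qed
qed

section \<open>Groups of order divisible by 3\<close>

text \<open>Cauchy's theorem for the prime 3. If 3 divides the order \<open>m\<close> of a cyclic
  top factor, a third of its generator gives \<open>x\<close> outside \<open>L\<close> with triple
  in \<open>L\<close>. Without elements of order 3, tripling permutes \<open>L\<close>, so some
  \<open>y\<close> in \<open>L\<close> has the same triple, and \<open>x - y\<close> has order
  3.\<close>

lemma ex_order_3:
  fixes K :: "'a::{ab_group_add, finite} set"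
  assumes "add_subgroup K" "3 dvd card K"
  shows "\<exists>x\<in>K. x \<noteq> 0 \<and> x + x + x = 0"
  using assms
proof (induction "card K" arbitrary: K rule: less_induct)
  case less
  note K = less.prems(1)
  have z: "add_subgroup {0::'a}" by (simp add: add_subgroup_def)
  have "K \<noteq> {0}" using less.prems(2) by auto
  then have "{0} \<subset> K" using add_subgroupD(1)[OF K] by auto
  then obtain L g where L: "add_subgroup L" "{0} \<subseteq> L" "L \<subset> K" "g \<in> K" "g \<notin> L" "adjoin L g = K"
    by (rule ex_cyclic_step[OF z K])
  obtain m where m: "0 < m" "\<And>i. nsmul i g \<in> L \<longleftrightarrow> m dvd i"
    "\<And>i j. i < m \<Longrightarrow> j < m \<Longrightarrow> nsmul i g - nsmul j g \<in> L \<Longrightarrow> i = j"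
    "adjoin L g = (\<Union>i<m. (+) (nsmul i g) ` L)"
    using cyclic_extension[OF L(1), of g] by blast
  have cK: "card K = m * card L" using card_adjoin[OF L(1) m(3,4,1)] L(6) by simp
  show ?case
  proof (cases "3 dvd card L")
    case True
    have "card L < card K" using L(3) by (simp add: psubset_card_mono)
    then show ?thesis using less.hyps[OF _ L(1) True] L(3) by blast
  next
    case False
    have "3 dvd m"
    proof (rule ccontr)
      assume "\<not> 3 dvd m"
      then have "m mod 3 = 1 \<or> m mod 3 = 2" "card L mod 3 = 1 \<or> card L mod 3 = 2"
        using False by presburger+
      then have "card K mod 3 \<noteq> 0" unfolding cK by (subst mult_mod_3) auto
      then show False using less.prems(2) by presburger
    qed
    then obtain j where j: "m = j * 3" by (metis dvdE mult.commute)
    define x where "x = nsmul j g"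
    have x: "x \<in> K" "x \<notin> L" using nsmul_mem[OF K L(4)] m(2)[of j] m(1) j by (auto simp: x_def dest: dvd_imp_le)
    have "nsmul (3 * j) g = x + x + x" by (simp only: nsmul_mult nsmul_three x_def)
    then have x3: "x + x + x \<in> L" using m(2)[of m] j by (simp add: mult.commute)
    show ?thesis
    proof (rule ccontr)
      assume no: "\<not> ?thesis"
      have inj: "inj_on (\<lambda>y. y + y + y) L"
      proof (rule inj_onI)
        fix y w assume yw: "y \<in> L" "w \<in> L" "y + y + y = w + w + w"
        then have "y - w \<in> K" using L(3) add_subgroupD(4)[OF L(1)] by blast
        moreover have "(y - w) + (y - w) + (y - w) = 0" using yw(3) by (simp add: algebra_simps)
        ultimately show "y = w" using no by auto
      qed
      have "(\<lambda>y. y + y + y) ` L \<subseteq> L" using add_subgroupD(2)[OF L(1)] by auto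
      then have "(\<lambda>y. y + y + y) ` L = L" by (rule endo_inj_surj[OF finite _ inj])
      then obtain y where y: "y \<in> L" "x + x + x = y + y + y" using x3 by auto
      have "(x - y) + (x - y) + (x - y) = 0" using y(2) by (simp add: algebra_simps)
      moreover have "x - y \<in> K" using x(1) y(1) L(3) add_subgroupD(4)[OF K] by blast
      ultimately have "x = y" using no by auto
      then show False using x(2) y(1) by simp
    qed
  qed
qed

text \<open>Tripling is not injective, so its range is proper; a cyclic quotient above that range is
  non-trivial and killed by 3.\<close>

lemma ex_index_3:
  assumes "3 dvd card (UNIV :: 'a::{ab_group_add, finite} set)"
  obtains K and g :: "'a::{ab_group_add, finite}" where "add_subgroup K" "g \<notin> K" "g + g \<notin> K" "g + g + g \<in> K"
    "\<And>y. y \<in> K \<or> y - g \<in> K \<or> y - (g + g) \<in> K" "card (UNIV :: 'a set) = 3 * card K"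
proof -
  define T where "T = range (\<lambda>x::'a. x + x + x)"
  have U: "add_subgroup (UNIV :: 'a set)" by (simp add: add_subgroup_def)
  have T: "add_subgroup T"
  proof (rule add_subgroup_finiteI)
    have "0 = 0 + 0 + (0::'a)" by simp
    then show "0 \<in> T" unfolding T_def by (rule range_eqI)
    fix x y assume "x \<in> T" "y \<in> T"
    then obtain a b where "x = a + a + a" "y = b + b + b" by (auto simp: T_def)
    then have "x + y = (a + b) + (a + b) + (a + b)" by (simp add: algebra_simps)
    then show "x + y \<in> T" unfolding T_def by (rule range_eqI)
  qed
  have "T \<noteq> UNIV"
  proof
    assume "T = UNIV"
    then have "inj (\<lambda>x::'a. x + x + x)" unfolding T_def by (rule finite_UNIV_surj_inj[OF finite])
    moreover obtain x :: 'a where "x \<noteq> 0" "x + x + x = 0" using ex_order_3[OF U assms] by auto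
    ultimately show False using injD[of "\<lambda>x::'a. x + x + x" x 0] by simp
  qed
  then have "T \<subset> UNIV" by auto
  then obtain K g where K: "add_subgroup K" "T \<subseteq> K" "K \<subset> UNIV" "g \<in> UNIV" "g \<notin> K" "adjoin K g = UNIV"
    by (rule ex_cyclic_step[OF T U])
  obtain m where m: "0 < m" "\<And>i. nsmul i g \<in> K \<longleftrightarrow> m dvd i"
    "\<And>i j. i < m \<Longrightarrow> j < m \<Longrightarrow> nsmul i g - nsmul j g \<in> K \<Longrightarrow> i = j"
    "adjoin K g = (\<Union>i<m. (+) (nsmul i g) ` K)"
    using cyclic_extension[OF K(1), of g] by blast
  have g3: "g + g + g \<in> K" using K(2) by (auto simp: T_def)
  then have "m dvd 3" using m(2)[of 3] by (simp add: nsmul_three)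
  moreover have "m \<noteq> 1" using m(2)[of 1] K(5) by simp
  moreover have "m \<le> 3" using dvd_imp_le[OF \<open>m dvd 3\<close>] by simp
  moreover have "m \<noteq> 2" using \<open>m dvd 3\<close> by auto
  ultimately have m3: "m = 3" using m(1) by linarith
  have "g + g \<notin> K" using m(2)[of 2] m3 by (simp add: nsmul_two)
  moreover have "y \<in> K \<or> y - g \<in> K \<or> y - (g + g) \<in> K" for y
  proof -
    have "{..<m} = {0, 1, 2}" using m3 by auto
    moreover have "y \<in> (\<Union>i<m. (+) (nsmul i g) ` K)" using m(4) K(6) by simp
    ultimately have "\<exists>i\<in>{0, 1, 2}. y \<in> (+) (nsmul i g) ` K" by simp
    then show ?thesis unfolding mem_coset_iff by (simp add: nsmul_two)
  qed
  moreover have "card (UNIV :: 'a set) = 3 * card K"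
    using card_adjoin[OF K(1) m(3,4,1)] K(6) m3 by simp
  ultimately show ?thesis using that K(1,5) g3 by blast
qed

lemma rho_maximal_4_iff:
  "rho_maximal 4 A \<longleftrightarrow> insert 0 A + insert 0 A + insert 0 A \<noteq> UNIV
     \<and> (\<forall>B. A \<subset> B \<longrightarrow> insert 0 B + insert 0 B + insert 0 B = UNIV)"
  unfolding rho_maximal_def four_le_diamA_iff by simp

text \<open>The set \<open>(K - {c}) \<union> {g}\<close> is a perturbation of the subgroup \<open>K\<close> of index 3; its threefold sumset
  misses \<open>g + g + c\<close>. For \<open>card K = 2\<close> the sums \<open>K - {c} + (K - {c})\<close> do not fill \<open>K\<close>, and one
  needs \<open>g + g + g = c\<close> instead.\<close>

lemma perturbed_index_3_subgroup:
  fixes K :: "'a::{ab_group_add, finite} set" and g c :: 'a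
  defines "A \<equiv> insert g (K - {c})"
  assumes K: "add_subgroup K" and g: "g \<notin> K" "g + g \<notin> K" "g + g + g \<in> K"
    and cov: "\<And>y. y \<in> K \<or> y - g \<in> K \<or> y - (g + g) \<in> K" and c: "c \<in> K" "c \<noteq> 0"
    and full: "(\<forall>z\<in>K. \<exists>x\<in>K - {c}. \<exists>y\<in>K - {c}. z = x + y) \<or> K = {0, c} \<and> g + g + g = c"
  shows "aperiodic A" "rho_maximal 4 A" "gen_subgroup A = UNIV" "card A = card K"
proof -
  note D = add_subgroupD[OF K]
  have 0: "0 \<in> A" using D(1) c by (simp add: A_def)
  have gA: "g \<in> A" by (simp add: A_def)
  have g0: "g \<noteq> 0" using D(1) g(1) by auto
  show "card A = card K"
    using g(1) c(1) card_Suc_Diff1[of K c] by (simp add: A_def)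
  have Kmem: "K \<subseteq> M" if M: "add_subgroup M" "A \<subseteq> M" for M
  proof
    fix z assume z: "z \<in> K"
    show "z \<in> M" using full
    proof (elim disjE conjE)
      assume "\<forall>z\<in>K. \<exists>x\<in>K - {c}. \<exists>y\<in>K - {c}. z = x + y"
      then obtain x y where "x \<in> K - {c}" "y \<in> K - {c}" "z = x + y" using z by blast
      then show ?thesis using M(2) add_subgroupD(2)[OF M(1)] by (auto simp: A_def)
    next
      assume "K = {0, c}" "g + g + g = c"
      moreover have "g \<in> M" using M(2) gA by auto
      then have "g + g + g \<in> M" using add_subgroupD(2)[OF M(1)] by blast
      ultimately show ?thesis using z add_subgroupD(1)[OF M(1)] by auto
    qed
  qed
  show "gen_subgroup A = UNIV"
    unfolding gen_subgroup_eq_UNIV_iff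
  proof (intro allI impI)
    fix M assume M: "add_subgroup M" "A \<subseteq> M"
    have gM: "g \<in> M" using M(2) gA by auto
    have KM: "K \<subseteq> M" by (rule Kmem[OF M])
    have "y \<in> M" for y
    proof -
      have "y - g + g \<in> M" if "y - g \<in> K" using that KM gM add_subgroupD(2)[OF M(1)] by blast
      moreover have "y - (g + g) + (g + g) \<in> M" if "y - (g + g) \<in> K"
        using that KM gM add_subgroupD(2)[OF M(1)] by blast
      ultimately show ?thesis using cov[of y] KM by auto
    qed
    then show "M = UNIV" by auto
  qed
  show "aperiodic A"
  proof -
    \<comment> \<open>Applied to 0 and \<open>g\<close>, a period is \<open>g\<close> or lies in
      \<open>K\<close>; the first would put \<open>g + g\<close> into \<open>A\<close>, the second
      forces \<open>g + p = g\<close>.\<close>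
    have "p = 0" if "p \<in> period A" for p
    proof -
      have p: "0 + p \<in> A" "g + p \<in> A" using that 0 gA by (simp_all only: mem_period_iff)
      show ?thesis
      proof (cases "p = g")
        case True
        then show ?thesis using p(2) g(2) g0 by (auto simp: A_def)
      next
        case False
        then have "p \<in> K" using p(1) by (simp add: A_def)
        then have "g + p \<notin> K" using g(1) by (simp add: add_subgroup_add_cancel[OF K])
        then show ?thesis using p(2) by (simp add: A_def)
      qed
    qed
    then show ?thesis unfolding aperiodic_def using add_subgroupD(1)[OF add_subgroup_period[of A]] by auto
  qed
  \<comment> \<open>To land in the coset of \<open>g + g\<close>, exactly two summands must be
    \<open>g\<close>; the third would be the removed element \<open>c\<close>.\<close>
  have miss: "g + g + c \<notin> A + A + A"
  proof
    assume "g + g + c \<in> A + A + A"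
    then obtain x y z where s: "x \<in> A" "y \<in> A" "z \<in> A" "g + g + c = x + y + z"
      by (auto elim!: set_plus_elim)
    have K1: "x = g \<or> x \<in> K \<and> x \<noteq> c" "y = g \<or> y \<in> K \<and> y \<noteq> c" "z = g \<or> z \<in> K \<and> z \<noteq> c"
      using s by (auto simp: A_def)
    have n0: "g + g + c \<notin> K" using g(2) c(1) by (simp add: add_subgroup_add_cancel[OF K])
    have n1: "g + g + c - g \<notin> K" using g(1) c(1) by (simp add: add_subgroup_add_cancel[OF K])
    have n3: "g + g + c - (g + g + g) \<notin> K"
    proof
      assume "g + g + c - (g + g + g) \<in> K"
      then have "c - (g + g + c - (g + g + g)) \<in> K" using c(1) D(4) by blast
      then show False using g(1) by (simp add: algebra_simps)
    qed
    have x0: "x + y + z \<in> K" if "x \<in> K" "y \<in> K" "z \<in> K" using that D(2) by blast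
    have x1: "x + y \<in> K" if "x \<in> K" "y \<in> K" using that D(2) by blast
    have x2: "y + z \<in> K" if "y \<in> K" "z \<in> K" using that D(2) by blast
    have x3: "x + z \<in> K" if "x \<in> K" "z \<in> K" using that D(2) by blast
    have e: "x + y + z - z = x + y" "x + y + z - x = y + z" "x + y + z - y = x + z" by simp_all
    show False
      using K1
    proof (elim disjE conjE)
      assume "x = g" "y = g" "z = g"
      then show False using n3 s(4) D(1) by simp
    next
      assume "x = g" "y = g" "z \<in> K" "z \<noteq> c"
      then show False using s(4) by simp
    next
      assume "x = g" "y \<in> K" "z = g" "y \<noteq> c"
      then show False using s(4) by (simp add: algebra_simps)
    next
      assume "x \<in> K" "y = g" "z = g" "x \<noteq> c"
      then show False using s(4) by (simp add: algebra_simps)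
    next
      assume "x = g" "y \<in> K" "z \<in> K"
      then show False using n1 s(4) x2 e(2) by metis
    next
      assume "x \<in> K" "y = g" "z \<in> K"
      then show False using n1 s(4) x3 e(3) by metis
    next
      assume "x \<in> K" "y \<in> K" "z = g"
      then show False using n1 s(4) x1 e(1) by metis
    next
      assume "x \<in> K" "y \<in> K" "z \<in> K"
      then show False using n0 s(4) x0 by simp
    qed
  qed
  have maxi: "B + B + B = UNIV" if AB: "A \<subseteq> B" and x: "x \<in> B" "x \<notin> A" for B x
  proof -
    have in3: "a + b + d \<in> B + B + B" if "a \<in> B" "b \<in> B" "d \<in> B" for a b d
      using that by (intro set_plus_intro)
    have B0: "0 \<in> B" and Bg: "g \<in> B" and BK: "\<And>a. a \<in> K \<Longrightarrow> a \<noteq> c \<Longrightarrow> a \<in> B"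
      using AB 0 gA by (auto simp: A_def)
    have xc: "x = c \<or> x \<notin> K" "x \<noteq> g" using x(2) by (auto simp: A_def)
    \<comment> \<open>In the coset of \<open>g + g\<close> only the point \<open>g + g + c\<close>
      has to be reached through the new element \<open>x\<close>.\<close>
    have G2: "y \<in> B + B + B" if y: "y - (g + g) \<in> K" "y \<noteq> g + g + c" for y
    proof -
      have "y - (g + g) \<in> B" using y by (intro BK) (auto simp: algebra_simps)
      then show ?thesis using in3[OF Bg Bg, of "y - (g + g)"] by simp
    qed
    have rest: "(\<forall>y\<in>K. y \<in> B + B + B) \<and> (\<forall>y. y - g \<in> K \<longrightarrow> y \<in> B + B + B) \<and> g + g + c \<in> B + B + B"
      using full
    proof (elim disjE conjE)
      assume F: "\<forall>z\<in>K. \<exists>x\<in>K - {c}. \<exists>y\<in>K - {c}. z = x + y"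
      have two: "\<exists>p\<in>B. \<exists>q\<in>B. z = p + q" if "z \<in> K" for z
      proof -
        obtain p q where "p \<in> K - {c}" "q \<in> K - {c}" "z = p + q" using F \<open>z \<in> K\<close> by blast
        then show ?thesis using BK by auto
      qed
      have three: "z + w \<in> B + B + B" if "z \<in> K" "w \<in> B" for z w
      proof -
        obtain p q where "p \<in> B" "q \<in> B" "z = p + q" using two[OF \<open>z \<in> K\<close>] by blast
        then show ?thesis using in3 \<open>w \<in> B\<close> by simp
      qed
      have "y \<in> B + B + B" if "y \<in> K" for y using three[OF that B0] by simp
      moreover have "y \<in> B + B + B" if "y - g \<in> K" for y using three[OF that Bg] by simp
      moreover have "g + g + c \<in> B + B + B"
      proof (cases "x = c")
        case True
        then show ?thesis using in3[OF Bg Bg x(1)] by simp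
      next
        case False
        \<comment> \<open>In \<open>g + K\<close> the complement \<open>c - (x - g)\<close> differs
          from \<open>c\<close> because \<open>x \<noteq> g\<close>, so it is available; in
          \<open>g + g + K\<close> the complement is a sum of two available elements.\<close>
        then consider "x - g \<in> K" | "x - (g + g) \<in> K" using cov[of x] xc by blast
        then show ?thesis
        proof cases
          case 1
          then have "c - (x - g) \<in> K" using c(1) D(4) by blast
          then have "c - (x - g) \<in> B" using xc(2) by (intro BK) auto
          then show ?thesis using in3[OF Bg x(1), of "c - (x - g)"] by (simp add: algebra_simps)
        next
          case 2
          then have "c - (x - (g + g)) \<in> K" using c(1) D(4) by blast
          then have "c - (x - (g + g)) + x \<in> B + B + B" using three x(1) by blast
          then show ?thesis by (simp add: algebra_simps)
        qed
      qed
      ultimately show ?thesis by blast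
    next
      assume K2: "K = {0, c}" and g3: "g + g + g = c"
      \<comment> \<open>Here the group is cyclic of order 6 with generator \<open>g\<close>,
        \<open>c\<close> is the triple of \<open>g\<close>, and \<open>A = {0, g}\<close>; the
        multiples 4 and 5 are to be reached with the help of \<open>x\<close>.\<close>
      have cc: "c + c = 0" using D(2)[OF c(1) c(1)] K2 c(2) by auto
      have g4: "c + g = g + g + g + g" and g5: "g + g + c = g + g + g + g + g" and g6: "g + g + g + g + g + g = 0"
        using cc by (simp_all add: g3[symmetric] add.assoc)
      have m0: "0 \<in> B + B + B" using in3[OF B0 B0 B0] by simp
      have m1: "g \<in> B + B + B" using in3[OF B0 B0 Bg] by simp
      have m3: "c \<in> B + B + B" using in3[OF Bg Bg Bg] by (simp add: g3)
      have six: "g + (g + (g + (g + (g + (g + z))))) = z" for z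
      proof -
        have "g + (g + (g + (g + (g + (g + z))))) = (g + g + g + g + g + g) + z" by (simp only: add.assoc)
        then show ?thesis by (simp add: g6)
      qed
      have "g + g + g + g \<in> B + B + B \<and> g + g + g + g + g \<in> B + B + B"
      proof -
        consider "x = g + g + g" | "x = g + g + g + g" | "x = g + g" | "x = g + g + g + g + g"
        proof -
          have "x = 0 \<or> x = c \<or> x = g \<or> x = c + g \<or> x = g + g \<or> x = g + g + c"
            using cov[of x] unfolding K2 by (auto simp: algebra_simps)
          moreover have "x \<noteq> 0" using x(2) 0 by auto
          ultimately show ?thesis using that xc(2) g3 g4 g5 by metis
        qed
        then show ?thesis
        proof cases
          case 1
          then show ?thesis using in3[OF x(1) Bg B0] in3[OF x(1) Bg Bg] by simp
        next
          case 2
          then show ?thesis using in3[OF x(1) B0 B0] in3[OF x(1) Bg B0] by simp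
        next
          case 3
          then show ?thesis using in3[OF x(1) x(1) B0] in3[OF x(1) x(1) Bg] by (simp add: add.assoc)
        next
          case 4
          have "x + x + 0 = g + g + g + g" by (simp add: 4 add.assoc six)
          then have "g + g + g + g \<in> B + B + B" using in3[OF x(1) x(1) B0] by argo
          then show ?thesis using in3[OF x(1) B0 B0] 4 by simp
        qed
      qed
      then have "c + g \<in> B + B + B" "g + g + c \<in> B + B + B" unfolding g4 g5 by blast+
      moreover have "y = g \<or> y = c + g" if "y - g \<in> K" for y using that K2 by (auto simp: algebra_simps)
      ultimately show ?thesis using m0 m1 m3 K2 by auto
    qed
    have "y \<in> B + B + B" for y using cov[of y] G2[of y] rest by blast
    then show ?thesis by auto
  qed
  show "rho_maximal 4 A"
    unfolding rho_maximal_4_iff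
  proof (intro conjI allI impI)
    show "insert 0 A + insert 0 A + insert 0 A \<noteq> UNIV" using miss 0 by (auto simp: insert_absorb)
    fix B assume "A \<subset> B"
    then obtain x where "x \<in> B" "x \<notin> A" "A \<subseteq> B" by auto
    then show "insert 0 B + insert 0 B + insert 0 B = UNIV" by (intro maxi[of _ x]) auto
  qed
qed

text \<open>Order at least 5 provides a non-zero \<open>c\<close> in \<open>K\<close>. If
  \<open>card K\<close> exceeds 2, \<open>K - {c}\<close> and \<open>z - (K - {c})\<close> intersect
  by pigeonhole; order 2 is treated separately.\<close>

lemma ex_aperiodic_maximal_3_dvd:
  assumes n3: "3 dvd card (UNIV :: 'a::{ab_group_add, finite} set)" and n5: "5 \<le> card (UNIV :: 'a set)"
  shows "\<exists>A :: 'a set. aperiodic A \<and> rho_maximal 4 A \<and> gen_subgroup A = UNIV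
           \<and> 3 * card A = card (UNIV :: 'a set)"
proof -
  obtain K and g :: 'a where K: "add_subgroup K" and g: "g \<notin> K" "g + g \<notin> K" "g + g + g \<in> K"
    and cov: "\<And>y. y \<in> K \<or> y - g \<in> K \<or> y - (g + g) \<in> K" and n: "card (UNIV :: 'a set) = 3 * card K"
    using ex_index_3[OF n3] by blast
  note D = add_subgroupD[OF K]
  have "2 \<le> card K" using n n5 by simp
  then have "K \<noteq> {0}" by auto
  then obtain c where c: "c \<in> K" "c \<noteq> 0" using D(1) by blast
  show ?thesis
  proof (cases "card K = 2")
    case True
    have "{0, c} \<subseteq> K" "card {0, c} = 2" using c D(1) by auto
    then have K2: "K = {0, c}" using True card_subset_eq[of K "{0, c}"] by simp
    have cc: "c + c = 0" using D(2)[OF c(1) c(1)] K2 c(2) by auto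
    obtain h where h: "h \<notin> K" "h + h \<notin> K" "h + h + h = c" "\<And>y. y \<in> K \<or> y - h \<in> K \<or> y - (h + h) \<in> K"
    proof (cases "g + g + g = c")
      case True
      then show ?thesis using that g cov by blast
    next
      case False
      then have g3: "g + g + g = 0" using g(3) K2 by auto
      \<comment> \<open>The triple of \<open>g + c\<close> is \<open>c\<close>, because
        \<open>g\<close> has triple 0 and \<open>c\<close> has order 2.\<close>
      let ?h = "g + c"
      have "?h + ?h = g + g + (c + c)" "?h + ?h + ?h = g + g + g + (c + c) + c"
        by (simp_all add: algebra_simps)
      then have h2: "?h + ?h = g + g" and h3: "?h + ?h + ?h = c" using cc g3 by simp_all
      have "?h \<notin> K" using g(1) c(1) by (simp add: add_subgroup_add_cancel[OF K])
      moreover have "y - ?h \<in> K" if "y - g \<in> K" for y using D(4)[OF that c(1)] by (simp add: algebra_simps)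
      ultimately show ?thesis using that[of ?h] g(2) h2 h3 cov by metis
    qed
    then have "h + h + h \<in> K" using c(1) by simp
    note P = perturbed_index_3_subgroup[OF K h(1,2) this h(4) c]
    have "K = {0, c} \<and> h + h + h = c" using K2 h(3) by simp
    then show ?thesis using P n by (intro exI[of _ "insert h (K - {c})"]) simp
  next
    case False
    have "\<exists>x\<in>K - {c}. \<exists>y\<in>K - {c}. z = x + y" if z: "z \<in> K" for z
    proof -
      let ?A = "K - {c}" and ?B = "(\<lambda>x. z - x) ` (K - {c})"
      have cA: "card ?A = card K - 1" using c(1) by simp
      have cB: "card ?B = card ?A" by (rule card_image) (auto simp: inj_on_def)
      have "?A \<union> ?B \<subseteq> K" using z D(4) by auto
      then have "card (?A \<union> ?B) \<le> card K" by (simp add: card_mono)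
      then have "?A \<inter> ?B \<noteq> {}"
        using cA cB card_Un_disjoint[of ?A ?B] False \<open>2 \<le> card K\<close> by auto
      then obtain x where "x \<in> ?A" "x \<in> ?B" by blast
      then obtain y where "y \<in> K - {c}" "x = z - y" by auto
      then show ?thesis using \<open>x \<in> ?A\<close> by (intro bexI[of _ x] bexI[of _ y]) auto
    qed
    then have F: "\<forall>z\<in>K. \<exists>x\<in>K - {c}. \<exists>y\<in>K - {c}. z = x + y" by blast
    note P = perturbed_index_3_subgroup[OF K g cov c disjI1[OF F]]
    show ?thesis using P n by (intro exI[of _ "insert g (K - {c})"]) simp
  qed
qed

section \<open>The extremal cardinalities\<close>

lemma Max_card_eqI:
  fixes P :: "'a::finite set \<Rightarrow> bool"
  assumes "P A" "\<And>B. P B \<Longrightarrow> card B \<le> card A"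
  shows "Max ({card B | B. P B} \<union> {0}) = card A"
proof (rule Max_eqI)
  show "finite ({card B | B. P B} \<union> {0})" by simp
qed (use assms in auto)

lemma aperiodic_maximal_card_bound:
  fixes A :: "'a::{ab_group_add, finite} set"
  assumes "aperiodic A" "rho_maximal 4 A"
  shows "3 * card A \<le> card (UNIV :: 'a set) + 1"
proof -
  define B where "B = insert 0 A"
  define H where "H = period (B + B)"
  have ne: "B \<noteq> {}" by (simp add: B_def)
  note hull = sumset_hull[OF ne, folded H_def]
  have 3: "B + B + B \<noteq> UNIV" using assms(2) by (simp add: rho_maximal_4_iff B_def)
  have "insert 0 (B + H) = B + H" using hull(2) by (auto simp: B_def)
  then have "\<not> A \<subset> B + H" using assms(2) hull(1) 3 unfolding rho_maximal_4_iff by metis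
  moreover have "A \<subseteq> B + H" using hull(2) by (auto simp: B_def)
  ultimately have A: "A = B + H" by auto
  then have "H \<subseteq> {0}" using hull(3) assms(1) by (simp add: aperiodic_def)
  then have "card H \<le> 1" using card_mono[of "{0}" H] by simp
  then show ?thesis using hull(4)[OF 3] A by simp
qed

section \<open>The values of \<open>t_rho\<close>\<close>

lemma t_rho_3_dvd:
  fixes G :: "'a::{ab_group_add, finite} itself"
  assumes "3 dvd card (UNIV :: 'a set)" "5 \<le> card (UNIV :: 'a set)"
  shows "3 * t_rho G 4 = card (UNIV :: 'a set)"
proof -
  obtain A :: "'a set" where A: "aperiodic A" "rho_maximal 4 A" "gen_subgroup A = UNIV"
    "3 * card A = card (UNIV :: 'a set)" using ex_aperiodic_maximal_3_dvd[OF assms] by blast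
  have "t_rho G 4 = card A" unfolding t_rho_def
  proof (rule Max_card_eqI)
    fix B :: "'a set" assume "aperiodic B \<and> rho_maximal 4 B \<and> gen_subgroup B = UNIV"
    then have "3 * card B \<le> 3 * card A + 1" using aperiodic_maximal_card_bound A(4) by metis
    then show "card B \<le> card A" by simp
  qed (use A in simp)
  then show ?thesis using A(4) by simp
qed

text \<open>The index \<open>m\<close> divides the group order, so it is 1 modulo 3, and
  \<open>3 * b \<le> m + 1\<close> sharpens to \<open>3 * b + 1 \<le> m\<close>. Covering sets that
  need be neither aperiodic nor generating, the bound also yields maximality.\<close>

lemma card_bound_all_dvd_1_mod_3:
  fixes B :: "'a::{ab_group_add, finite} set"
  assumes dv: "\<forall>d. d dvd card (UNIV :: 'a set) \<longrightarrow> d mod 3 = 1" and B: "B \<noteq> {}" "B + B + B \<noteq> UNIV"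
  shows "3 * card B + 1 \<le> card (UNIV :: 'a set)"
proof -
  define H where "H = period (B + B)"
  note hull = sumset_hull[OF B(1), folded H_def]
  have H: "add_subgroup H" by (simp add: H_def add_subgroup_period)
  have pos: "0 < card H" using card_subgroup_pos[OF H] .
  define m where "m = card (cosets H)"
  define b where "b = card ((\<lambda>s. (+) s ` H) ` (B + H))"
  have n: "card (UNIV :: 'a set) = card H * m" by (simp add: m_def card_cosets[OF H])
  have D: "card (B + H) = card H * b" unfolding b_def by (rule card_periodic[OF H hull(3)])
  have "card H * (3 * b) \<le> card H * (m + 1)" using hull(4)[OF B(2)] n D by (simp add: algebra_simps)
  then have "3 * b \<le> m + 1" using pos by (simp only: mult_le_cancel1)
  moreover have "m mod 3 = 1" using dv n by simp
  ultimately have "3 * b + 1 \<le> m" by presburger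
  then have "card H * (3 * b + 1) \<le> card H * m" by (rule mult_le_mono2)
  then have "3 * card (B + H) + card H \<le> card (UNIV :: 'a set)" using n D by simp
  moreover have "card B \<le> card (B + H)" using hull(2) by (simp add: card_mono)
  ultimately show ?thesis using pos by simp
qed

lemma add_subgroup_0: "add_subgroup {0}"
  by (simp add: add_subgroup_def)

lemma zero_ne_UNIV:
  assumes "1 < card (UNIV :: 'a::zero set)"
  shows "{0} \<noteq> (UNIV :: 'a set)"
proof
  assume "{0} = (UNIV :: 'a set)"
  then have "card (UNIV :: 'a set) = card {0::'a}" by simp
  then show False using assms by simp
qed

text \<open>A set attaining the sharp bound is automatically maximal. It is aperiodic because the
  order of its period divides both \<open>card A\<close> and \<open>3 * card A + 1\<close>. Exponent
  2 would give the group order the divisor 2.\<close>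

lemma t_rho_all_dvd_1_mod_3:
  fixes G :: "'a::{ab_group_add, finite} itself"
  assumes dv: "\<forall>d. d dvd card (UNIV :: 'a set) \<longrightarrow> d mod 3 = 1"
    and n5: "5 \<le> card (UNIV :: 'a set)"
  shows "3 * t_rho G 4 + 1 = card (UNIV :: 'a set)"
proof -
  have n1: "card (UNIV :: 'a set) mod 3 = 1" using dv by simp
  have "\<exists>g::'a. g + g \<notin> {0}"
  proof (rule ccontr)
    assume n: "\<not> ?thesis"
    obtain g :: 'a where g: "g \<noteq> 0"
    proof -
      have "{0} \<noteq> (UNIV :: 'a set)" by (rule zero_ne_UNIV) (use n5 in simp)
      then show ?thesis using that by blast
    qed
    have "add_subgroup {0, g}" by (rule add_subgroup_finiteI) (use n in auto)
    then have "card {0, g} dvd card (UNIV :: 'a set)" using card_cosets by (metis dvd_triv_left)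
    moreover have "card {0, g} = 2" using g by simp
    ultimately show False using dv by force
  qed
  then obtain A :: "'a set" where A: "0 \<in> A" "gen_subgroup A = UNIV" "A + A + A \<noteq> UNIV"
    "card (UNIV :: 'a set) \<le> 3 * card A + 1"
    using ex_large_generating_set[OF add_subgroup_0, of "card (UNIV :: 'a set)"] n1 n5 by auto
  have A0: "insert 0 A = A" using A(1) by auto
  have cA: "3 * card A + 1 = card (UNIV :: 'a set)"
    using card_bound_all_dvd_1_mod_3[OF dv, of A] A by auto
  have "rho_maximal 4 A" unfolding rho_maximal_4_iff A0
  proof (intro conjI allI impI)
    fix B assume "A \<subset> B"
    then have "card A < card (insert 0 B)" using psubset_card_mono[of "insert 0 B" A] by auto
    then have "\<not> 3 * card (insert 0 B) + 1 \<le> card (UNIV :: 'a set)" using cA by simp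
    then show "insert 0 B + insert 0 B + insert 0 B = UNIV"
      using card_bound_all_dvd_1_mod_3[OF dv, of "insert 0 B"] by blast
  qed (rule A(3))
  moreover have "aperiodic A"
  proof -
    let ?P = "period A"
    have P: "add_subgroup ?P" by (rule add_subgroup_period)
    have "card ?P dvd card A" using card_periodic[OF P, of A] by (metis dvd_triv_left subset_refl)
    then have "card ?P dvd 3 * card A" by simp
    moreover have "card ?P dvd 3 * card A + 1" unfolding cA using card_cosets[OF P] by simp
    ultimately have "card ?P = 1" by (metis dvd_add_right_iff nat_dvd_1_iff_1)
    then show ?thesis unfolding aperiodic_def using add_subgroupD(1)[OF P] by (auto simp: card_1_singleton_iff)
  qed
  ultimately have "t_rho G 4 = card A" unfolding t_rho_def
  proof (intro Max_card_eqI)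
    fix B :: "'a set" assume "aperiodic B \<and> rho_maximal 4 B \<and> gen_subgroup B = UNIV"
    then have "3 * card B \<le> 3 * card A + 2" using aperiodic_maximal_card_bound[of B] cA by auto
    then show "card B \<le> card A" by simp
  qed (use A in simp)
  then show ?thesis using cA by simp
qed

section \<open>The quantity \<open>eta\<close> and the value of \<open>s_rho\<close>\<close>

lemma eta_ge:
  fixes H :: "'a::{ab_group_add, finite} set"
  assumes H: "add_subgroup H" and "card (cosets H) mod 3 = 2" and sq: "\<exists>g::'a. g + g \<notin> H"
  shows "card H \<le> eta (G :: 'a itself)"
proof -
  have "H \<noteq> UNIV" using sq by auto
  then have "exp_quot H \<noteq> 2" using exp_quot_eq_2_iff[OF H] sq by auto
  then show ?thesis unfolding eta_def using assms by (intro Max_ge) auto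
qed

lemma eta_attained:
  fixes G :: "'a::{ab_group_add, finite} itself"
  assumes "eta G \<noteq> 0"
  obtains H :: "'a set" where "add_subgroup H" "card (cosets H) mod 3 = 2" "\<exists>g::'a. g + g \<notin> H"
    "card H = eta G"
proof -
  let ?S = "{card (H::'a set) | H. add_subgroup H \<and> exp_quot H \<noteq> 2 \<and> card (cosets H) mod 3 = 2}"
  have "eta G \<in> ?S \<union> {0}" unfolding eta_def by (rule Max_in) simp_all
  then obtain H :: "'a set" where H: "add_subgroup H" "exp_quot H \<noteq> 2" "card (cosets H) mod 3 = 2" "card H = eta G"
    using assms by auto
  have "H \<noteq> UNIV"
  proof
    assume "H = UNIV"
    then have "card (cosets H) = 1" using card_cosets[OF H(1)] card_subgroup_pos[OF H(1)] by simp
    then show False using H(3) by simp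
  qed
  then show ?thesis using that H exp_quot_eq_2_iff[OF H(1)] by blast
qed

text \<open>Inserting 0 preserves the sumsets and the generated subgroup and never shrinks the set,
  so only sets containing 0 compete.\<close>

lemma s_rho_4_eqI:
  fixes A :: "'a::{ab_group_add, finite} set"
  assumes "0 \<in> A" "gen_subgroup A = UNIV" "A + A + A \<noteq> UNIV"
    and le: "\<And>B :: 'a set. 0 \<in> B \<Longrightarrow> gen_subgroup B = UNIV \<Longrightarrow> B + B + B \<noteq> UNIV \<Longrightarrow> card B \<le> card A"
  shows "s_rho (G :: 'a itself) 4 = card A"
  unfolding s_rho_def four_le_diamA_iff diamA_less_infinity_iff
proof (rule Max_card_eqI)
  fix B :: "'a set"
  assume "insert 0 B + insert 0 B + insert 0 B \<noteq> UNIV \<and> gen_subgroup B = UNIV"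
  then have "card (insert 0 B) \<le> card A" by (intro le) auto
  moreover have "card B \<le> card (insert 0 B)" by (rule card_mono) auto
  ultimately show "card B \<le> card A" by simp
qed (use assms in \<open>simp add: insert_absorb\<close>)

text \<open>One upper bound serves all cases. It is attained over a subgroup realizing
  \<open>eta\<close>, by the perturbed subgroup of index 3 (with 0 inserted), or over the trivial
  subgroup.\<close>

lemma s_rho_4:
  fixes G :: "'a::{ab_group_add, finite} itself"
  assumes n5: "5 \<le> card (UNIV :: 'a set)" and e2: "group_exp G \<noteq> 2"
  shows "3 * s_rho G 4 = (if eta G \<noteq> 0 then card (UNIV :: 'a set) + eta G
           else if 3 dvd card (UNIV :: 'a set) then card (UNIV :: 'a set) else card (UNIV :: 'a set) - 1)"
proof -
  let ?n = "card (UNIV :: 'a set)"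
  have bound: "3 * card B \<le> ?n + eta G \<and> (eta G = 0 \<longrightarrow> \<not> 3 dvd ?n \<longrightarrow> 3 * card B < ?n)"
    if "0 \<in> B" "gen_subgroup B = UNIV" "B + B + B \<noteq> UNIV" for B :: "'a set"
    using card_le_of_three_sumset_ne_UNIV[OF that]
  proof (elim disjE exE conjE)
    fix H :: "'a set" and g :: 'a
    assume H: "add_subgroup H" "card (cosets H) mod 3 = 2" "g + g \<notin> H" "3 * card B \<le> ?n + card H"
    then have "card H \<le> eta G" using eta_ge by blast
    then show ?thesis using H(4) card_subgroup_pos[OF H(1)] by simp
  next
    assume "3 * card B \<le> ?n" "\<not> 3 dvd ?n \<longrightarrow> 3 * card B < ?n"
    then show ?thesis by simp
  qed
  have sq: "\<exists>g::'a. g + g \<notin> {0}"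
  proof -
    have "group_exp G = exp_quot {0::'a}" by (simp add: group_exp_def exp_quot_def)
    moreover have "{0} \<noteq> (UNIV :: 'a set)" by (rule zero_ne_UNIV) (use n5 in simp)
    ultimately show ?thesis using exp_quot_eq_2_iff[OF add_subgroup_0] e2 by metis
  qed
  show ?thesis
  proof (cases "eta G = 0")
    case False
    then obtain H :: "'a set" where H: "add_subgroup H" "card (cosets H) mod 3 = 2" "\<exists>g::'a. g + g \<notin> H"
      "card H = eta G" by (rule eta_attained)
    have q: "?n = card (cosets H) * card H" using card_cosets[OF H(1)] by simp
    have "card (cosets H) \<noteq> 4" using H(2) by auto
    then obtain A :: "'a set" where A: "0 \<in> A" "gen_subgroup A = UNIV" "A + A + A \<noteq> UNIV"
      "?n + card H \<le> 3 * card A"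
      using ex_large_generating_set[OF H(1,3) q] H(2) by auto
    have cA: "3 * card A = ?n + eta G" using A(4) bound[OF A(1-3)] H(4) by simp
    have "s_rho G 4 = card A"
    proof (rule s_rho_4_eqI[OF A(1-3)])
      fix B :: "'a set" assume "0 \<in> B" "gen_subgroup B = UNIV" "B + B + B \<noteq> UNIV"
      then show "card B \<le> card A" using bound[of B] cA by simp
    qed
    then show ?thesis using cA False by simp
  next
    case True
    show ?thesis
    proof (cases "3 dvd ?n")
      case 3: True
      obtain A :: "'a set" where A: "rho_maximal 4 A" "gen_subgroup A = UNIV" "3 * card A = ?n"
        using ex_aperiodic_maximal_3_dvd[OF 3 n5] by blast
      let ?A = "insert 0 A"
      have A': "0 \<in> ?A" "gen_subgroup ?A = UNIV" "?A + ?A + ?A \<noteq> UNIV"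
        using A by (simp_all add: rho_maximal_4_iff)
      have "card A \<le> card ?A" by (rule card_mono) auto
      then have cA: "3 * card ?A = ?n" using A(3) bound[OF A'] True by simp
      have "s_rho G 4 = card ?A"
      proof (rule s_rho_4_eqI[OF A'])
        fix B :: "'a set" assume "0 \<in> B" "gen_subgroup B = UNIV" "B + B + B \<noteq> UNIV"
        then show "card B \<le> card ?A" using bound[of B] cA True by simp
      qed
      then show ?thesis using cA True 3 by simp
    next
      case n3: False
      have c0: "?n = card (cosets {0::'a})" using card_cosets[OF add_subgroup_0] by simp
      \<comment> \<open>Otherwise the trivial subgroup would count for \<open>eta\<close>, the
        exponent of the group not being 2.\<close>
      have "?n mod 3 \<noteq> 2" using eta_ge[OF add_subgroup_0 _ sq, of G] c0 True by auto
      then have n1: "?n mod 3 = 1" using n3 by presburger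
      obtain A :: "'a set" where A: "0 \<in> A" "gen_subgroup A = UNIV" "A + A + A \<noteq> UNIV"
        "?n \<le> 3 * card A + 1"
        using ex_large_generating_set[OF add_subgroup_0 sq, of ?n] n1 n5 by auto
      have cA: "3 * card A + 1 = ?n" using A(4) bound[OF A(1-3)] True n3 by simp
      have "s_rho G 4 = card A"
      proof (rule s_rho_4_eqI[OF A(1-3)])
        fix B :: "'a set" assume "0 \<in> B" "gen_subgroup B = UNIV" "B + B + B \<noteq> UNIV"
        then show "card B \<le> card A" using bound[of B] cA True n3 by simp
      qed
      then show ?thesis using cA True n3 by simp
    qed
  qed
qed

theorem theorem2p7:
  fixes G :: "'a::{ab_group_add, finite} itself"
  assumes "diam G \<ge> 4"
  shows "(3 dvd card (UNIV::'a set) \<longrightarrow> real (t_rho G 4) = real (card (UNIV::'a set)) / 3)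
       \<and> ((\<forall>d. d dvd card (UNIV::'a set) \<longrightarrow> d mod 3 = 1) \<longrightarrow> real (t_rho G 4) = (real (card (UNIV::'a set)) - 1) / 3)
       \<and> (group_exp G \<noteq> 2 \<longrightarrow>
            real (s_rho G 4) =
              (if eta G \<noteq> 0 then (real (card (UNIV::'a set)) + real (eta G)) / 3
               else if 3 dvd card (UNIV::'a set) then real (card (UNIV::'a set)) / 3
               else (real (card (UNIV::'a set)) - 1) / 3))"
proof (intro conjI impI)
  have n5: "5 \<le> card (UNIV :: 'a set)" using card_ge_5[OF assms] .
  show "real (t_rho G 4) = real (card (UNIV::'a set)) / 3" if "3 dvd card (UNIV :: 'a set)"
    unfolding t_rho_3_dvd[OF that n5, of G, symmetric] by simp
  show "real (t_rho G 4) = (real (card (UNIV::'a set)) - 1) / 3"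
    if "\<forall>d. d dvd card (UNIV :: 'a set) \<longrightarrow> d mod 3 = 1"
    unfolding t_rho_all_dvd_1_mod_3[OF that n5, of G, symmetric] by simp
  have "3 * real (s_rho G 4) =
              (if eta G \<noteq> 0 then real (card (UNIV::'a set)) + real (eta G)
               else if 3 dvd card (UNIV::'a set) then real (card (UNIV::'a set))
               else real (card (UNIV::'a set)) - 1)" if "group_exp G \<noteq> 2"
  proof -
    have "3 * real (s_rho G 4) = real (3 * s_rho G 4)" by simp
    \<comment> \<open>The order is positive, so natural subtraction of 1 agrees with the real
      one.\<close>
    then show ?thesis unfolding s_rho_4[OF n5 that] using n5 by (simp add: of_nat_diff)
  qed
  then show "real (s_rho G 4) =
              (if eta G \<noteq> 0 then (real (card (UNIV::'a set)) + real (eta G)) / 3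
               else if 3 dvd card (UNIV::'a set) then real (card (UNIV::'a set)) / 3
               else (real (card (UNIV::'a set)) - 1) / 3)" if "group_exp G \<noteq> 2"
    using that by (simp split: if_splits)
qed

end
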